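(* Let $k\in\mathbb{N}$ and let $A$ be an analytic function in $\mathbb{D}$ such that $\sigma_{M,\deg}(A)=p_2\in(0,\infty)$ and $\lambda_{M,\deg}(A)=p_1$. Then: (a) all solutions $f$ of $f^{(k)}+Af=0$ with $\sigma_M(f)>0$ satisfy $$\frac{p_1}{k}-1\le 1+\left(\lambda_M(f)-\frac{\lambda_M(f)}{\sigma_M(f)}\right)^+;$$ (b) if $2k<k\left(2+\frac{p_2-2k}{p_2}\right)<p_1\le p_2$, then all non-trivial solutions $f$ of $f^{(k)}+Af=0$ satisfy $$\lambda_M(f)-\left(1-\frac{\lambda_M(f)}{\sigma_M(f)}\right)\le\frac{p_1}{k}-1\le\frac{p_2}{k}-1=\sigma_M(f).$$
   Context: $\mathbb{D}=\{z\in\mathbb{C}:|z|<1\}$, $\mathbb{N}=\{1,2,\dots\}$, $M(r,g)=\max_{|z|=r}|g(z)|$, $x^+=\max\{x,0\}$, and $\log^+x=\max\{\log x,0\}$ (with $\log^+0=0$). For $f$ analytic in $\mathbb{D}$, the order and lower order of growth are $$\sigma_M(f)=\limsup_{r\to1^-}\frac{\log^+\log^+M(r,f)}{\log\frac1{1-r}},\qquad \lambda_M(f)=\liminf_{r\to1^-}\frac{\log^+\log^+M(r,f)}{\log\frac1{1-r}}.$$ For $A$ analytic in $\mathbb{D}$, the degree and lower degree of growth are $$\sigma_{M,\deg}(A)=\limsup_{r\to1^-}\frac{\log^+M(r,A)}{\log\frac1{1-r}},\qquad \lambda_{M,\deg}(A)=\liminf_{r\to1^-}\frac{\log^+M(r,A)}{\log\frac1{1-r}}.$$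 Solutions are analytic functions in $\mathbb{D}$; non-trivial means not identically zero. *)

theory Defs
  imports "HOL-Analysis.Analysis"
begin

text \<open>
  For \<open>g\<close> continuous on the circle \<open>|z| = r\<close> with \<open>r \<ge> 0\<close>, the circle is compact and nonempty,
  so this supremum is attained and equals the maximum of \<open>|g|\<close> there.
\<close>
definition max_modulus :: "real \<Rightarrow> (complex \<Rightarrow> complex) \<Rightarrow> real" where
  "max_modulus r g = (SUP z\<in>sphere 0 r. cmod (g z))"

definition log_plus :: "real \<Rightarrow> real" where
  "log_plus x = (if x = 0 then 0 else max (ln x) 0)"

text \<open>
  The growth indicators take values in the extended reals, since the upper and lower limits
  may be infinite.
\<close>
definition order_growth :: "(complex \<Rightarrow> complex) \<Rightarrow> ereal" where
  "order_growth f =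
     Limsup (at_left 1) (\<lambda>r. ereal (log_plus (log_plus (max_modulus r f)) / ln (1 / (1 - r))))"

definition lower_order_growth :: "(complex \<Rightarrow> complex) \<Rightarrow> ereal" where
  "lower_order_growth f =
     Liminf (at_left 1) (\<lambda>r. ereal (log_plus (log_plus (max_modulus r f)) / ln (1 / (1 - r))))"

definition degree_growth :: "(complex \<Rightarrow> complex) \<Rightarrow> ereal" where
  "degree_growth A =
     Limsup (at_left 1) (\<lambda>r. ereal (log_plus (max_modulus r A) / ln (1 / (1 - r))))"

definition lower_degree_growth :: "(complex \<Rightarrow> complex) \<Rightarrow> ereal" where
  "lower_degree_growth A =
     Liminf (at_left 1) (\<lambda>r. ereal (log_plus (max_modulus r A) / ln (1 / (1 - r))))"

definition disc_solution :: "nat \<Rightarrow> (complex \<Rightarrow> complex) \<Rightarrow> (complex \<Rightarrow> complex) \<Rightarrow> bool" where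
  "disc_solution k A f \<longleftrightarrow>
     f analytic_on ball 0 1 \<and> (\<forall>z\<in>ball 0 1. (deriv ^^ k) f z + A z * f z = 0)"

definition nontrivial_on_disc :: "(complex \<Rightarrow> complex) \<Rightarrow> bool" where
  "nontrivial_on_disc f \<longleftrightarrow> (\<exists>z\<in>ball 0 1. f z \<noteq> 0)"

end

theory Submission
  imports Defs "HOL-Complex_Analysis.Complex_Analysis" "HOL-Real_Asymp.Real_Asymp"
begin

text \<open>
  Upper bounds for the growth of \<open>f\<close> come from comparing all derivatives of \<open>f\<close> along a ray with
  \<open>K H\<^sup>j E\<close>, where \<open>H = C (1 + \<delta> - s) powr (- q)\<close> dominates the \<open>k\<close>-th root of the coefficient and
  \<open>E' = H E\<close>. With \<open>\<delta> = 0\<close> this bounds the order by \<open>p\<^sub>2 / k - 1\<close>. At radii \<open>1 - d\<close> where the maximum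
  modulus of \<open>A\<close> is about \<open>d powr (- p\<^sub>1)\<close>, the shift \<open>\<delta> = d powr (p\<^sub>1 / p\<^sub>2)\<close> bounds the lower order by
  \<open>p\<^sub>1 / k - p\<^sub>1 / p\<^sub>2\<close>.

  Upper bounds for \<open>A = - (deriv ^^ k) f / f\<close> come from a logarithmic derivative estimate. Suppose
  \<open>ln |f(z)| \<le> Q (1 - |z|) powr (- \<beta>)\<close> for \<open>|z| \<le> 1 - d\<close>, with \<open>\<beta> < 1\<close>. Transplant \<open>f\<close> to the unit disc
  by a map onto a domain having a corner of opening \<open>\<alpha> \<pi>\<close>, \<open>\<alpha> < 1\<close>, at a boundary point. There the
  bound becomes \<open>Q |1 - w| powr (- \<alpha> \<beta>)\<close> up to a constant, which has a harmonic majorant, so that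
  dividing by an explicit exponential gives a function bounded by \<open>1\<close> whose value at \<open>0\<close> is at least
  \<open>exp (- O(Q))\<close>. Jensen's and Harnack's inequalities then control its zeros and its size near the
  corner. On a suitable small circle around a point near the corner,
  \<open>f\<close> varies at most by a constant factor at a scale just below \<open>d\<^sup>2 / Q\<close>, and Cauchy's estimate bounds \<open>A\<close> by about \<open>(Q / d\<^sup>2) ^ k\<close>. Interpolation
  between the bounds given by the order and by the lower order supplies \<open>Q\<close>.
\<close>

subsection \<open>Bounded functions in the unit disc\<close>

text \<open>The Schwarz lemma asks for strict inequality; apply it to \<open>t * f\<close> with
  \<open>t < 1\<close> and let \<open>t\<close> tend to \<open>1\<close> from the left.\<close>

lemma Schwarz_weak:
  assumes holf: "f holomorphic_on ball 0 1" and f0: "f 0 = 0"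
    and le1: "\<And>z. cmod z < 1 \<Longrightarrow> cmod (f z) \<le> 1" and z: "cmod z < 1"
  shows "cmod (f z) \<le> cmod z"
proof -
  have scaled: "t * cmod (f z) \<le> cmod z" if t: "t \<in> {0<..<1}" for t
  proof -
    have "cmod (of_real t * f z) \<le> cmod z"
    proof (rule Schwarz_Lemma(1))
      show "(\<lambda>z. of_real t * f z) holomorphic_on ball 0 1"
        by (intro holomorphic_intros holf)
      show "cmod (of_real t * f w) < 1" if "cmod w < 1" for w
      proof -
        have "t * cmod (f w) \<le> t * 1" using le1[OF that] t by (intro mult_left_mono) auto
        moreover have "0 < t" "t < 1" using t by auto
        ultimately show ?thesis by (simp only: norm_mult norm_of_real)
      qed
    qed (use f0 z in auto)
    then show ?thesis using t by (simp add: norm_mult)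
  qed
  have "((\<lambda>t. t * cmod (f z)) \<longlongrightarrow> 1 * cmod (f z)) (at_left (1::real))"
    by (intro tendsto_intros)
  moreover have "eventually (\<lambda>t. t * cmod (f z) \<le> cmod z) (at_left (1::real))"
    using eventually_at_left_real[of 0 1] scaled by (auto elim: eventually_mono)
  ultimately show ?thesis
    using tendsto_upperbound trivial_limit_at_left_real by force
qed

lemma Blaschke_denominator_nonzero:
  assumes "cmod a < 1" "cmod z < 1"
  shows "1 - cnj a * z \<noteq> 0"
proof
  assume "1 - cnj a * z = 0"
  then have "cmod (cnj a * z) = 1" by (metis norm_one right_minus_eq)
  then show False using assms by (metis complex_mod_cnj norm_mult_less mult_1 less_irrefl)
qed

text \<open>Composing \<open>G\<close> with the disc automorphism that moves \<open>0\<close> to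
  \<open>a\<close> gives a function vanishing at \<open>0\<close>, so the Schwarz lemma bounds
  \<open>G\<close> by the Blaschke factor of \<open>a\<close>. The quotient therefore stays bounded
  by \<open>1\<close> away from \<open>a\<close>.\<close>

lemma divide_Blaschke_factor:
  assumes holG: "G holomorphic_on ball 0 1" and le1: "\<And>z. cmod z < 1 \<Longrightarrow> cmod (G z) \<le> 1"
    and a: "cmod a < 1" "G a = 0"
  obtains g where "g holomorphic_on ball 0 1" "\<And>z. cmod z < 1 \<Longrightarrow> cmod (g z) \<le> 1"
    "\<And>z. cmod z < 1 \<Longrightarrow> G z = Moebius_function 0 a z * g z"
proof -
  have SP: "cmod (G z) \<le> cmod (Moebius_function 0 a z)" if z: "cmod z < 1" for z
  proof -
    have "cmod ((G \<circ> Moebius_function 0 (-a)) (Moebius_function 0 a z)) \<le> cmod (Moebius_function 0 a z)"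
    proof (rule Schwarz_weak)
      show "G \<circ> Moebius_function 0 (-a) holomorphic_on ball 0 1"
        by (rule holomorphic_on_compose_gen[OF Moebius_function_holomorphic holG])
           (use a Moebius_function_norm_lt_1 in auto)
    qed (use a z le1 Moebius_function_norm_lt_1 in \<open>auto simp: Moebius_function_of_zero\<close>)
    then show ?thesis using Moebius_function_compose[of "-a" a z] a z by simp
  qed
  \<comment> \<open>The difference quotient removes the singularity at \<open>a\<close>; multiplying
    it by the denominator of the Blaschke factor gives the desired quotient without dividing by
    zero.\<close>
  define q where "q = (\<lambda>z. if z = a then deriv G a else (G z - G a) / (z - a))"
  have holq: "q holomorphic_on ball 0 1"
    unfolding q_def by (rule pole_lemma[OF holG]) (use a in auto)
  define g where "g = (\<lambda>z. q z * (1 - cnj a * z))"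
  have holg: "g holomorphic_on ball 0 1" unfolding g_def by (intro holomorphic_intros holq)
  have eq: "G z = Moebius_function 0 a z * g z" if "cmod z < 1" for z
    using Blaschke_denominator_nonzero[OF a(1) that] a(2)
    by (auto simp: g_def q_def Moebius_function_def)
  have g1: "cmod (g z) \<le> 1" if z: "cmod z < 1" "z \<noteq> a" for z
  proof -
    have "Moebius_function 0 a z \<noteq> 0"
      using Blaschke_denominator_nonzero[OF a(1) z(1)] z(2) by (simp add: Moebius_function_def)
    then show ?thesis
      using SP[OF z(1)] eq[OF z(1)] by (simp add: norm_mult)
  qed
  \<comment> \<open>The bound at \<open>a\<close> itself follows from a circle around
    \<open>a\<close>, on which it is already known, by Cauchy's inequality of order
    \<open>0\<close>.\<close>
  have "cmod (g a) \<le> 1"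
  proof -
    define r where "r = (1 - cmod a) / 2"
    have sub: "cball a r \<subseteq> ball 0 1"
    proof
      fix w assume "w \<in> cball a r"
      then have "cmod (w - a) \<le> r" by (simp add: dist_norm norm_minus_commute)
      then have "cmod w \<le> cmod a + r" using norm_triangle_sub[of w a] by linarith
      moreover have "2 * r = 1 - cmod a" by (simp add: r_def)
      ultimately have "cmod w < 1" using a(1) by linarith
      then show "w \<in> ball 0 1" by simp
    qed
    have "cmod ((deriv ^^ 0) g a) \<le> fact 0 * 1 / r ^ 0"
    proof (rule Cauchy_inequality)
      show "g holomorphic_on ball a r" using sub holg by (meson ball_subset_cball holomorphic_on_subset subset_trans)
      show "continuous_on (cball a r) g" using sub holg by (meson holomorphic_on_imp_continuous_on holomorphic_on_subset)
      show "0 < r" using a by (simp add: r_def)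
      show "cmod (g x) \<le> 1" if "cmod (a - x) = r" for x
      proof -
        have "x \<in> cball a r" using that by (simp add: dist_norm)
        then have "cmod x < 1" using sub by auto
        then show ?thesis using g1 that \<open>0 < r\<close> by force
      qed
    qed
    then show ?thesis by simp
  qed
  then show thesis using that[OF holg _ eq] g1 by metis
qed

text \<open>
  Each zero in \<open>|z| \<le> r\<close> multiplies the value at \<open>0\<close> by at least \<open>1 / r\<close>, so fewer than \<open>N\<close> divisions
  are possible; no multiplicities need to be counted.
\<close>
lemma Blaschke_factorization:
  assumes "0 < r" "r < 1"
    and "G holomorphic_on ball 0 1" "\<And>z. cmod z < 1 \<Longrightarrow> cmod (G z) \<le> 1" "r ^ N < cmod (G 0)"
  obtains as g where "g holomorphic_on ball 0 1" "\<And>z. cmod z < 1 \<Longrightarrow> cmod (g z) \<le> 1"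
    "\<And>z. cmod z \<le> r \<Longrightarrow> g z \<noteq> 0"
    "\<And>a. a \<in> set as \<Longrightarrow> cmod a \<le> r" "cmod (G 0) \<le> r ^ length as" "cmod (G 0) \<le> cmod (g 0)"
    "\<And>z. cmod z < 1 \<Longrightarrow> G z = (\<Prod>a\<leftarrow>as. Moebius_function 0 a z) * g z"
  using assms(3-)
proof (induction N arbitrary: G thesis)
  case 0
  have "cmod (G 0) \<le> 1" by (rule "0.prems"(3)) simp
  then show ?case using "0.prems"(4) by simp
next
  case (Suc N)
  show ?case
  proof (cases "\<forall>z. cmod z \<le> r \<longrightarrow> G z \<noteq> 0")
    case True
    then show ?thesis using Suc.prems(1)[of G "[]"] Suc.prems by simp
  next
    case False
    then obtain a where a: "cmod a \<le> r" "G a = 0" by auto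
    have G0: "0 < cmod (G 0)" using Suc.prems(4) assms(1) by (meson less_trans zero_less_power)
    obtain g where g: "g holomorphic_on ball 0 1" "\<And>z. cmod z < 1 \<Longrightarrow> cmod (g z) \<le> 1"
      "\<And>z. cmod z < 1 \<Longrightarrow> G z = Moebius_function 0 a z * g z"
      using divide_Blaschke_factor[OF Suc.prems(2,3), of a] a assms(2) by (metis le_less_trans)
    have Gg: "cmod (G 0) = cmod a * cmod (g 0)"
      using g(3)[of 0] by (simp add: Moebius_function_of_zero norm_mult)
    have a0: "0 < cmod a" using G0 Gg by auto
    have le: "cmod (G 0) \<le> r * cmod (g 0)" unfolding Gg using a by (intro mult_right_mono) auto
    then have "r * r ^ N < r * cmod (g 0)" using Suc.prems(4) by simp
    then have "r ^ N < cmod (g 0)" using assms(1) by simp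
    then obtain h as where h: "h holomorphic_on ball 0 1" "\<And>z. cmod z < 1 \<Longrightarrow> cmod (h z) \<le> 1"
      "\<And>z. cmod z \<le> r \<Longrightarrow> h z \<noteq> 0"
      "\<And>a. a \<in> set as \<Longrightarrow> cmod a \<le> r" "cmod (g 0) \<le> r ^ length as" "cmod (g 0) \<le> cmod (h 0)"
      "\<And>z. cmod z < 1 \<Longrightarrow> g z = (\<Prod>a\<leftarrow>as. Moebius_function 0 a z) * h z"
      using Suc.IH[OF _ g(1,2)] by metis
    show ?thesis
    proof (rule Suc.prems(1)[of h "a # as"])
      show "cmod (G 0) \<le> r ^ length (a # as)"
        using order_trans[OF le mult_left_mono[OF h(5), of r]] assms(1) by simp
      have "cmod (G 0) \<le> cmod (g 0)"
        using le mult_right_mono[of r 1 "cmod (g 0)"] assms(2) by simp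
      then show "cmod (G 0) \<le> cmod (h 0)" using h(6) by linarith
      show "G z = (\<Prod>a\<leftarrow>a # as. Moebius_function 0 a z) * h z" if "cmod z < 1" for z
        using g(3)[OF that] h(7)[OF that] by simp
    qed (use h a in auto)
  qed
qed

section \<open>Harnack-type estimates for zero-free functions\<close>

lemma positive_real_part_bound:
  assumes holk: "k holomorphic_on ball 0 r" and r: "0 < r"
    and Re: "\<And>z. cmod z < r \<Longrightarrow> 0 < Re (k z)" and k0: "k 0 = of_real V" and z: "cmod z < r"
  shows "cmod (k z) \<le> 2 * V * r / (r - cmod z)"
proof -
  have V: "V > 0" using Re[of 0] k0 r by simp
  \<comment> \<open>The Cayley transform centred at \<open>V = k 0\<close> takes the right half
    plane into the unit disc and \<open>k 0\<close> to \<open>0\<close>, which makes the Schwarz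
    lemma applicable after rescaling the radius.\<close>
  define \<phi> where "\<phi> = (\<lambda>w. (k (of_real r * w) - of_real V) / (k (of_real r * w) + of_real V))"
  have in_ball: "cmod (of_real r * w) < r" if "cmod w < 1" for w
    using that r by (simp add: norm_mult)
  have nz: "k (of_real r * w) + of_real V \<noteq> 0" if "cmod w < 1" for w
    using Re[OF in_ball[OF that]] V by (metis Re_complex_of_real add_pos_pos less_irrefl plus_complex.simps(1) zero_complex.simps(1))
  have hol: "(\<lambda>w. k (of_real r * w)) holomorphic_on ball 0 1"
    by (rule holomorphic_on_compose_gen[of "\<lambda>w. of_real r * w" _ k "ball 0 r", unfolded o_def])
       (use in_ball in \<open>auto intro!: holomorphic_intros holk\<close>)
  define w where "w = z / of_real r"
  have w: "cmod w < 1" "of_real r * w = z" using z r by (auto simp: w_def norm_divide)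
  have "cmod (\<phi> w) \<le> cmod w"
  proof (rule Schwarz_weak)
    show "\<phi> holomorphic_on ball 0 1"
      unfolding \<phi>_def by (intro holomorphic_intros hol) (use nz in auto)
    show "\<phi> 0 = 0" by (simp add: \<phi>_def k0)
    show "cmod (\<phi> u) \<le> 1" if u: "cmod u < 1" for u
    proof -
      have "Re (k (of_real r * u)) > 0" using Re in_ball u by blast
      then have "cmod (k (of_real r * u) - of_real V) \<le> cmod (k (of_real r * u) + of_real V)"
        using V by (auto simp: cmod_def power2_eq_square algebra_simps)
      then show ?thesis using nz[OF u] by (simp add: \<phi>_def norm_divide)
    qed
  qed (use w in auto)
  moreover have "cmod w = cmod z / r" using r by (simp add: w_def norm_divide)
  ultimately have "cmod (k z - of_real V) / cmod (k z + of_real V) \<le> cmod z / r"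
    using w by (simp add: \<phi>_def norm_divide)
  then have "cmod (k z - of_real V) \<le> cmod z / r * cmod (k z + of_real V)"
    using nz[OF w(1)] w by (simp add: pos_divide_le_eq)
  then have "r * cmod (k z - of_real V) \<le> cmod z * cmod (k z + of_real V)"
    using r by (simp add: field_simps)
  moreover have "cmod (k z) - V \<le> cmod (k z - of_real V)"
    using norm_triangle_ineq2[of "k z" "of_real V"] V by simp
  moreover have "cmod (k z + of_real V) \<le> cmod (k z) + V"
    using norm_triangle_ineq[of "k z" "of_real V"] V by simp
  ultimately have "r * (cmod (k z) - V) \<le> cmod z * (cmod (k z) + V)"
    by (meson mult_left_mono norm_ge_zero order_trans r less_imp_le)
  then have "cmod (k z) * (r - cmod z) \<le> V * (r + cmod z)" by (simp add: algebra_simps)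
  also have "\<dots> \<le> V * (2 * r)" using V z by (intro mult_left_mono) auto
  finally show ?thesis using z by (simp add: pos_le_divide_eq mult.commute mult.left_commute)
qed

text \<open>A zero-free function has a holomorphic logarithm, whose real part is nonpositive here.
  The half-plane bound and Cauchy's inequality control the derivative of that logarithm on the
  smaller disc; integrating along a segment and exponentiating compares two values.\<close>

lemma zero_free_quotient_bound:
  assumes holg: "g holomorphic_on ball 0 r" and \<rho>: "0 < \<rho>" "\<rho> < r"
    and le1: "\<And>z. cmod z < r \<Longrightarrow> cmod (g z) \<le> 1" and nz: "\<And>z. cmod z < r \<Longrightarrow> g z \<noteq> 0"
    and g0: "exp (- V) \<le> cmod (g 0)" and r1: "r \<le> 1"
    and u: "cmod u \<le> \<rho>" and v: "cmod v \<le> \<rho>"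
  shows "cmod (g u) \<le> cmod (g v) * exp (8 * (V + 1) / (r - \<rho>)\<^sup>2 * cmod (u - v))"
proof -
  obtain h where holh: "h holomorphic_on ball 0 r" and gh: "\<And>z. z \<in> ball 0 r \<Longrightarrow> g z = exp (h z)"
    using contractible_imp_holomorphic_log[OF holg convex_imp_contractible[OF convex_ball]] nz
    by (metis mem_ball_0)
  \<comment> \<open>The summand \<open>1\<close> makes the real part of \<open>k\<close> strictly
    positive even where \<open>|g| = 1\<close>, and the imaginary constant makes \<open>k 0\<close>
    real. This is why \<open>V + 1\<close> appears in the bound.\<close>
  define V1 where "V1 = 1 - Re (h 0)"
  define k where "k = (\<lambda>z. 1 + \<i> * Im (h 0) - h z)"
  have holk: "k holomorphic_on ball 0 r" unfolding k_def by (intro holomorphic_intros holh)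
  have Reh: "Re (h z) \<le> 0" if "cmod z < r" for z
  proof -
    have "exp (Re (h z)) \<le> 1" using le1[OF that] gh[of z] that by simp
    then show ?thesis by simp
  qed
  have V1: "0 < V1" "V1 \<le> V + 1"
  proof -
    show "0 < V1" using Reh[of 0] \<rho> by (simp add: V1_def)
    show "V1 \<le> V + 1" using g0 gh[of 0] \<rho> by (simp add: V1_def)
  qed
  have kb: "cmod (k z) \<le> 2 * V1 * r / (r - cmod z)" if "cmod z < r" for z
  proof (rule positive_real_part_bound[OF holk])
    show "0 < Re (k z)" if "cmod z < r" for z using Reh[OF that] by (simp add: k_def)
    show "k 0 = of_real V1" by (simp add: k_def V1_def complex_eq_iff)
  qed (use that \<rho> in auto)
  have kd: "cmod (deriv k z) \<le> 8 * (V + 1) / (r - \<rho>)\<^sup>2" if z: "z \<in> cball 0 \<rho>" for z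
  proof -
    define s where "s = (r - \<rho>) / 2"
    have s: "s > 0" using \<rho> by (simp add: s_def)
    have s2: "2 * s = r - \<rho>" by (simp add: s_def)
    have sub: "cmod w \<le> \<rho> + s" if "w \<in> cball z s" for w
      using that z norm_triangle_sub[of w z] by (simp add: dist_norm norm_minus_commute)
    have sub': "cball z s \<subseteq> ball 0 r"
    proof
      fix w assume "w \<in> cball z s"
      then have "cmod w \<le> \<rho> + s" by (rule sub)
      then have "cmod w < r" using s s2 by linarith
      then show "w \<in> ball 0 r" by simp
    qed
    have "cmod ((deriv ^^ 1) k z) \<le> fact 1 * (2 * V1 * r / s) / s ^ 1"
    proof (rule Cauchy_inequality)
      show "k holomorphic_on ball z s" using sub' holk by (meson ball_subset_cball holomorphic_on_subset subset_trans)
      show "continuous_on (cball z s) k" using sub' holk by (meson holomorphic_on_imp_continuous_on holomorphic_on_subset)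
      show "cmod (k x) \<le> 2 * V1 * r / s" if "cmod (z - x) = s" for x
      proof -
        have x: "x \<in> cball z s" using that by (simp add: dist_norm)
        have sx: "s \<le> r - cmod x" using sub[OF x] s2 by linarith
        have "cmod (k x) \<le> 2 * V1 * r / (r - cmod x)"
          using kb s sx by auto
        also have "\<dots> \<le> 2 * V1 * r / s"
          using sx V1 \<rho> s by (intro divide_left_mono mult_pos_pos) auto
        finally show ?thesis .
      qed
    qed (rule s)
    also have "\<dots> = 8 * (V1 * r) / (r - \<rho>)\<^sup>2" by (simp add: s_def power2_eq_square)
    also have "\<dots> \<le> 8 * ((V + 1) * 1) / (r - \<rho>)\<^sup>2"
      using V1 r1 \<rho> by (intro divide_right_mono mult_left_mono mult_mono) auto
    finally show ?thesis by simp
  qed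
  have "cmod (k v - k u) \<le> 8 * (V + 1) / (r - \<rho>)\<^sup>2 * cmod (v - u)"
  proof (rule field_differentiable_bound[of "cball 0 \<rho>" k "deriv k"])
    show "(k has_field_derivative deriv k z) (at z within cball 0 \<rho>)" if "z \<in> cball 0 \<rho>" for z
      by (rule has_field_derivative_at_within, rule holomorphic_derivI[OF holk]) (use that \<rho> in auto)
  qed (use kd u v in auto)
  moreover have "Re (k v - k u) \<le> cmod (k v - k u)" by (rule complex_Re_le_cmod)
  moreover have "Re (k v - k u) = Re (h u) - Re (h v)" by (simp add: k_def)
  ultimately have "Re (h u) \<le> Re (h v) + 8 * (V + 1) / (r - \<rho>)\<^sup>2 * cmod (u - v)"
    by (simp add: norm_minus_commute)
  then have "exp (Re (h u)) \<le> exp (Re (h v) + 8 * (V + 1) / (r - \<rho>)\<^sup>2 * cmod (u - v))"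
    by (simp only: exp_le_cancel_iff)
  moreover have "cmod (g u) = exp (Re (h u))" "cmod (g v) = exp (Re (h v))"
    using gh[of u] gh[of v] u v \<rho> by auto
  ultimately show ?thesis by (simp only: exp_add)
qed

text \<open>
  Averaging \<open>|t - b\<^sub>i| powr (- 1 / p)\<close>, which is integrable, over \<open>t\<close> yields a sum of order
  \<open>n powr p\<close> instead of the optimal \<open>n ln n\<close>.
\<close>
lemma exists_point_off_poles:
  fixes b :: "'i \<Rightarrow> real" and x y p :: real
  assumes fin: "finite I" and xy: "x < y" and p: "1 < p"
  obtains t where "x < t" "t < y" "\<And>i. i \<in> I \<Longrightarrow> t \<noteq> b i"
    "(\<Sum>i\<in>I. 1 / \<bar>t - b i\<bar>) \<le> (3 * p / (p - 1) * real (card I)) powr p / (y - x)"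
proof (cases "I = {}")
  case True
  then show ?thesis using that[of "(x + y) / 2"] xy by simp
next
  case False
  define l where "l = y - x"
  have l: "l > 0" using xy by (simp add: l_def)
  define n where "n = real (card I)"
  have n: "n > 0" using False fin by (simp add: n_def card_gt_0_iff)
  \<comment> \<open>The exponent \<open>q - 1 = - 1 / p\<close> exceeds \<open>-1\<close>, hence is
    integrable at a pole, and raising the resulting power to \<open>p\<close> recovers the
    reciprocal distance.\<close>
  define q where "q = 1 - 1 / p"
  have q: "0 < q" "q < 1" "q - 1 = - (1 / p)" using p by (auto simp: q_def field_simps)
  define c where "c i = max x (min y (b i))" for i
  \<comment> \<open>The mean of \<open>s\<close> over the interval is at most
    \<open>2 * n * l powr (q - 1) / q\<close>; the factor \<open>3\<close> in place of
    \<open>2\<close> yields a strict contradiction. Below, \<open>\<phi> a\<close> is a continuous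
    antiderivative of \<open>|t - a| powr (q - 1)\<close>.\<close>
  define K where "K = 3 * n * l powr (q - 1) / q"
  define \<phi> where "\<phi> a t = ((max (t - a) 0) powr q - (max (a - t) 0) powr q) / q" for a t :: real
  define s where "s t = (\<Sum>i\<in>I. \<bar>t - c i\<bar> powr (q - 1))" for t
  have "\<exists>t\<in>{x<..<y} - c ` I. s t \<le> K"
  proof (rule ccontr)
    assume "\<not> ?thesis"
    then have big: "K < s t" if "t \<in> {x<..<y} - c ` I" for t using that by force
    \<comment> \<open>Setting the integrand to \<open>K\<close> at the finitely many poles and the
      endpoints keeps \<open>K \<le> f'\<close> on the whole interval; the fundamental theorem
      tolerates these exceptional points.\<close>
    define f' where "f' t = (if t \<in> {x<..<y} - c ` I then s t else K)" for t
    have "(f' has_integral ((\<Sum>i\<in>I. \<phi> (c i) y) - (\<Sum>i\<in>I. \<phi> (c i) x))) {x..y}"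
    proof (rule fundamental_theorem_of_calculus_interior_strong[of "c ` I"])
      show "continuous_on {x..y} (\<lambda>t. \<Sum>i\<in>I. \<phi> (c i) t)"
        unfolding \<phi>_def using q by (intro continuous_intros continuous_on_powr') auto
      fix t assume t: "t \<in> {x<..<y} - c ` I"
      have der: "(\<phi> a has_real_derivative \<bar>t - a\<bar> powr (q - 1)) (at t)" if "a \<noteq> t" for a
      proof (cases "a < t")
        case True
        have "((\<lambda>t. (t - a) powr q / q) has_real_derivative \<bar>t - a\<bar> powr (q - 1)) (at t)"
          using True q by (auto intro!: derivative_eq_intros)
        then show ?thesis
          by (rule DERIV_cong_ev[THEN iffD1, rotated -1, OF _ refl _ refl])
             (use True eventually_gt_at_top order_tendstoD(1)[OF tendsto_ident_at, of a t UNIV] in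
               \<open>auto simp: \<phi>_def eventually_nhds intro!: exI[of _ "{a<..}"]\<close>)
      next
        case False
        then have at: "t < a" using that by simp
        have "((\<lambda>t. - ((a - t) powr q / q)) has_real_derivative \<bar>t - a\<bar> powr (q - 1)) (at t)"
          using at q by (auto intro!: derivative_eq_intros)
        then show ?thesis
          by (rule DERIV_cong_ev[THEN iffD1, rotated -1, OF _ refl _ refl])
             (use at in \<open>auto simp: \<phi>_def eventually_nhds intro!: exI[of _ "{..<a}"]\<close>)
      qed
      have "((\<lambda>t. \<Sum>i\<in>I. \<phi> (c i) t) has_real_derivative s t) (at t)"
        unfolding s_def by (intro DERIV_sum der) (use t in auto)
      then show "((\<lambda>t. \<Sum>i\<in>I. \<phi> (c i) t) has_vector_derivative f' t) (at t)"
        using t by (simp add: f'_def has_real_derivative_iff_has_vector_derivative)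
    qed (use fin xy in auto)
    moreover have "((\<lambda>_. K) has_integral (K * l)) {x..y}"
      using has_integral_const_real[of K x y] xy by (simp add: l_def mult.commute)
    ultimately have "K * l \<le> (\<Sum>i\<in>I. \<phi> (c i) y) - (\<Sum>i\<in>I. \<phi> (c i) x)"
      by (elim has_integral_le[rotated]) (use big in \<open>auto simp: f'_def intro: less_imp_le\<close>)
    also have "\<dots> = (\<Sum>i\<in>I. \<phi> (c i) y - \<phi> (c i) x)" by (simp add: sum_subtractf)
    also have "\<dots> \<le> (\<Sum>i\<in>I. 2 * l powr q / q)"
    proof (rule sum_mono)
      fix i
      have ci: "x \<le> c i" "c i \<le> y" using xy by (auto simp: c_def)
      then have "(y - c i) powr q \<le> l powr q" "(c i - x) powr q \<le> l powr q"
        using q by (auto simp: l_def intro!: powr_mono2)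
      moreover have "\<phi> (c i) y - \<phi> (c i) x = ((y - c i) powr q + (c i - x) powr q) / q"
        using ci q by (auto simp: \<phi>_def max_def field_simps)
      ultimately show "\<phi> (c i) y - \<phi> (c i) x \<le> 2 * l powr q / q"
        using q by (simp add: divide_right_mono)
    qed
    also have "\<dots> = 2 * n * (l powr (q - 1) * l) / q"
      using powr_mult_base[of l "q - 1"] l by (simp add: n_def mult.commute)
    finally have "3 * (n * l powr (q - 1) * l / q) \<le> 2 * (n * l powr (q - 1) * l / q)"
      by (simp add: K_def mult_ac)
    moreover have "0 < n * l powr (q - 1) * l / q" using n l q by simp
    ultimately show False by (simp only: mult_le_cancel_right) simp
  qed
  then obtain t where t: "x < t" "t < y" "t \<notin> c ` I" "s t \<le> K" by auto
  have tc: "\<bar>t - c i\<bar> \<le> \<bar>t - b i\<bar>" "0 < \<bar>t - c i\<bar>" if "i \<in> I" for i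
    using t that by (auto simp: c_def)
  \<comment> \<open>Since \<open>X i powr p\<close> is the reciprocal distance and each
    \<open>X i\<close> is at most their sum \<open>s t\<close>, the sum of the \<open>p\<close>-th
    powers is at most \<open>s t powr p\<close>.\<close>
  define X where "X i = \<bar>t - c i\<bar> powr (q - 1)" for i
  have Xs: "X i \<le> s t" if "i \<in> I" for i
    unfolding s_def X_def using fin that by (intro member_le_sum) auto
  have s0: "0 \<le> s t" by (auto simp: s_def intro: sum_nonneg)
  have bound: "1 / \<bar>t - b i\<bar> \<le> X i * s t powr (p - 1)" if i: "i \<in> I" for i
  proof -
    have "1 / \<bar>t - b i\<bar> \<le> 1 / \<bar>t - c i\<bar>" using tc[OF i] by (intro divide_left_mono) auto
    also have "\<dots> = X i powr p"
    proof -
      have "X i powr p = \<bar>t - c i\<bar> powr (- (1 / p) * p)" by (simp only: X_def powr_powr q(3))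
      also have "- (1 / p) * p = - 1" using p by simp
      finally show ?thesis by (simp add: powr_minus_divide)
    qed
    also have "\<dots> = X i * X i powr (p - 1)"
      using powr_mult_base[of "X i" "p - 1"] by (simp add: X_def)
    also have "\<dots> \<le> X i * s t powr (p - 1)"
      using Xs[OF i] p by (intro mult_left_mono powr_mono2) (auto simp: X_def)
    finally show ?thesis .
  qed
  have "(\<Sum>i\<in>I. 1 / \<bar>t - b i\<bar>) \<le> (\<Sum>i\<in>I. X i * s t powr (p - 1))"
    using bound by (rule sum_mono)
  also have "\<dots> = s t * s t powr (p - 1)" by (simp add: s_def X_def sum_distrib_right)
  also have "\<dots> = s t powr p" using powr_mult_base[OF s0, of "p - 1"] by simp
  also have "\<dots> \<le> K powr p" using t s0 p by (intro powr_mono2) auto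
  also have "K = (3 * p / (p - 1) * n) * l powr (- (1 / p))"
    using p q by (simp add: K_def q_def field_simps)
  also have "\<dots> powr p = (3 * p / (p - 1) * n) powr p * l powr (- (1 / p) * p)"
    using p n l by (subst powr_mult) (auto simp: powr_powr)
  also have "- (1 / p) * p = - 1" using p by simp
  also have "(3 * p / (p - 1) * n) powr p * l powr (- 1) = (3 * p / (p - 1) * n) powr p / l"
    using l by (simp add: powr_minus_divide)
  finally have "(\<Sum>i\<in>I. 1 / \<bar>t - b i\<bar>) \<le> (3 * p / (p - 1) * real (card I)) powr p / (y - x)"
    by (simp only: l_def n_def)
  moreover have "t \<noteq> b i" if "i \<in> I" for i using tc[OF that] by auto
  ultimately show ?thesis using that[of t] t by blast
qed

section \<open>Local stability of Blaschke products and bounded functions\<close>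

lemma Blaschke_factor_quotient:
  assumes a: "cmod a < 1" and w: "cmod w \<le> 1 - e" and v: "cmod v < 1" and e: "0 < e" and av: "v \<noteq> a"
  shows "cmod (Moebius_function 0 a w)
    \<le> cmod (Moebius_function 0 a v) * exp (cmod (w - v) * (1 / cmod (v - a) + 1 / e))"
proof -
  define \<delta> where "\<delta> = cmod (w - v)"
  \<comment> \<open>Numerator and denominator are compared separately: each relative change
    \<open>x\<close> is absorbed by \<open>1 + x \<le> exp x\<close>. The numerator is measured
    against its value at \<open>v\<close>, the denominator against its value at \<open>w\<close>,
    which is at least \<open>e\<close>.\<close>
  have "cmod (w - a) \<le> cmod (v - a) + \<delta>"
    using norm_triangle_ineq[of "v - a" "w - v"] by (simp add: \<delta>_def)
  also have "\<dots> = cmod (v - a) * (1 + \<delta> / cmod (v - a))" using av by (simp add: field_simps)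
  also have "\<dots> \<le> cmod (v - a) * exp (\<delta> / cmod (v - a))"
    by (intro mult_left_mono exp_ge_add_one_self) auto
  finally have 1: "cmod (w - a) \<le> cmod (v - a) * exp (\<delta> / cmod (v - a))" .
  have "cmod (cnj a * w) \<le> 1 * (1 - e)"
    unfolding norm_mult using a w by (intro mult_mono) auto
  then have den: "e \<le> cmod (1 - cnj a * w)"
    using norm_triangle_ineq2[of 1 "cnj a * w"] by simp
  have "cmod (1 - cnj a * v) \<le> cmod (1 - cnj a * w) + cmod (cnj a * (w - v))"
    using norm_triangle_ineq[of "1 - cnj a * w" "cnj a * (w - v)"] by (simp add: algebra_simps)
  also have "cmod (cnj a * (w - v)) \<le> 1 * \<delta>"
    unfolding norm_mult \<delta>_def using a by (intro mult_right_mono) auto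
  also have "\<dots> = e * (\<delta> / e)" using e by simp
  also have "\<dots> \<le> cmod (1 - cnj a * w) * (\<delta> / e)"
    using den e by (intro mult_right_mono) (auto simp: \<delta>_def)
  also have "cmod (1 - cnj a * w) + \<dots> = cmod (1 - cnj a * w) * (1 + \<delta> / e)"
    by (simp add: algebra_simps)
  also have "\<dots> \<le> cmod (1 - cnj a * w) * exp (\<delta> / e)"
    by (intro mult_left_mono exp_ge_add_one_self) auto
  finally have 2: "cmod (1 - cnj a * v) \<le> cmod (1 - cnj a * w) * exp (\<delta> / e)" by simp
  have pos: "0 < cmod (1 - cnj a * w)" "0 < cmod (1 - cnj a * v)"
    using den e Blaschke_denominator_nonzero[OF a v] by auto
  have "cmod (w - a) * cmod (1 - cnj a * v)
      \<le> (cmod (v - a) * exp (\<delta> / cmod (v - a))) * (cmod (1 - cnj a * w) * exp (\<delta> / e))"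
    using 1 2 by (intro mult_mono) auto
  then have "cmod (w - a) / cmod (1 - cnj a * w)
      \<le> cmod (v - a) / cmod (1 - cnj a * v) * (exp (\<delta> / cmod (v - a)) * exp (\<delta> / e))"
    using pos by (simp add: pos_divide_le_eq pos_le_divide_eq mult_ac)
  then show ?thesis
    by (simp add: Moebius_function_simple norm_divide \<delta>_def distrib_left flip: exp_add)
qed

lemma Blaschke_product_quotient:
  assumes "\<And>a. a \<in> set as \<Longrightarrow> cmod a < 1 \<and> v \<noteq> a" "cmod w \<le> 1 - e" "cmod v < 1" "0 < e"
  shows "cmod (\<Prod>a\<leftarrow>as. Moebius_function 0 a w)
    \<le> cmod (\<Prod>a\<leftarrow>as. Moebius_function 0 a v) * exp (cmod (w - v) * (\<Sum>a\<leftarrow>as. 1 / cmod (v - a) + 1 / e))"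
  using assms(1)
proof (induction as)
  case (Cons a as)
  have "cmod (\<Prod>a\<leftarrow>a # as. Moebius_function 0 a w)
      = cmod (Moebius_function 0 a w) * cmod (\<Prod>a\<leftarrow>as. Moebius_function 0 a w)"
    by (simp add: norm_mult)
  also have "\<dots> \<le> (cmod (Moebius_function 0 a v) * exp (cmod (w - v) * (1 / cmod (v - a) + 1 / e)))
      * (cmod (\<Prod>a\<leftarrow>as. Moebius_function 0 a v) * exp (cmod (w - v) * (\<Sum>a\<leftarrow>as. 1 / cmod (v - a) + 1 / e)))"
    using Cons Blaschke_factor_quotient[of a w e v] assms(2-) by (intro mult_mono) auto
  also have "\<dots> = cmod (\<Prod>a\<leftarrow>a # as. Moebius_function 0 a v)
      * exp (cmod (w - v) * (\<Sum>a\<leftarrow>a # as. 1 / cmod (v - a) + 1 / e))"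
    by (simp add: norm_mult distrib_left exp_add mult_ac)
  finally show ?case .
qed simp

text \<open>Divide out the zeros in a disc reaching three quarters of the way from \<open>w0\<close>
  to the unit circle. A radius whose circle avoids the zeros quantitatively controls the Blaschke
  product, and the Harnack-type estimate controls the zero-free remainder. A whole circle is needed
  so that bounds on it can later be carried to its centre by the maximum principle.\<close>

lemma bounded_function_stable_on_circle:
  fixes p :: real
  assumes p: "1 < p"
  obtains c where "0 < c" "c \<le> 1 / 16" "\<And>G V w0. \<lbrakk>G holomorphic_on ball 0 1; \<And>z. cmod z < 1 \<Longrightarrow> cmod (G z) \<le> 1;
      exp (- V) \<le> cmod (G 0); 1 \<le> V; cmod w0 < 1\<rbrakk> \<Longrightarrow>
      \<exists>t>(1 - cmod w0) / 4. t < (1 - cmod w0) / 2 \<and> (\<forall>v w. cmod (v - w0) = t \<longrightarrow>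
        cmod (w - v) \<le> c * ((1 - cmod w0) powr (1 + p) / V powr p) \<longrightarrow>
        G v \<noteq> 0 \<and> cmod (G w) \<le> exp 1 * cmod (G v))"
proof -
  define K where "K = 3 * p / (p - 1)"
  have K: "K > 0" using p by (simp add: K_def)
  \<comment> \<open>The first summand accounts for the distances to the zeros. The rest is
    \<open>16 + 1024\<close>: the denominators of the Blaschke factors and the zero-free
    quotient.\<close>
  define M where "M = 4 * (4 * K) powr p + 1040"
  have M: "M \<ge> 1040" by (simp add: M_def)
  have "\<exists>t>(1 - cmod w0) / 4. t < (1 - cmod w0) / 2 \<and> (\<forall>v w. cmod (v - w0) = t \<longrightarrow>
        cmod (w - v) \<le> 1 / M * ((1 - cmod w0) powr (1 + p) / V powr p) \<longrightarrow>
        G v \<noteq> 0 \<and> cmod (G w) \<le> exp 1 * cmod (G v))"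
    if holG: "G holomorphic_on ball 0 1" and G1: "\<And>z. cmod z < 1 \<Longrightarrow> cmod (G z) \<le> 1"
      and G0: "exp (- V) \<le> cmod (G 0)" and V: "1 \<le> V" and w0: "cmod w0 < 1" for G V w0
  proof -
    define \<tau> where "\<tau> = 1 - cmod w0"
    have \<tau>: "0 < \<tau>" "\<tau> \<le> 1" using w0 by (auto simp: \<tau>_def)
    define r where "r = 1 - \<tau> / 4"
    have r: "0 < r" "r < 1" using \<tau> by (auto simp: r_def)
    obtain N where "r ^ N < exp (- V)" using real_arch_pow_inv[of "exp (- V)" r] r by auto
    then have "r ^ N < cmod (G 0)" using G0 by simp
    then obtain as g where g: "g holomorphic_on ball 0 1" "\<And>z. cmod z < 1 \<Longrightarrow> cmod (g z) \<le> 1"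
        "\<And>z. cmod z \<le> r \<Longrightarrow> g z \<noteq> 0"
      and as: "\<And>a. a \<in> set as \<Longrightarrow> cmod a \<le> r" "cmod (G 0) \<le> r ^ length as"
      and g0: "cmod (G 0) \<le> cmod (g 0)"
      and Gg: "\<And>z. cmod z < 1 \<Longrightarrow> G z = (\<Prod>a\<leftarrow>as. Moebius_function 0 a z) * g z"
      using Blaschke_factorization[OF r holG G1] by metis
    define n where "n = real (length as)"
    \<comment> \<open>Jensen-type count: every removed zero costs a factor \<open>r\<close> at the
      origin, so \<open>exp (- V) \<le> r powr n\<close>, while
      \<open>ln r \<le> - \<tau> / 4\<close>.\<close>
    have n: "0 \<le> n" "n \<le> 4 * V / \<tau>"
    proof -
      have "exp (- V) \<le> r powr n" using G0 as(2) r by (simp add: n_def powr_realpow)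
      then have "- V \<le> n * ln r" using r by (simp add: powr_def)
      also have "\<dots> \<le> n * (- \<tau> / 4)"
        using ln_le_minus_one[of r] r by (intro mult_left_mono) (auto simp: n_def r_def)
      finally show "n \<le> 4 * V / \<tau>" using \<tau> by (simp add: field_simps)
    qed (simp add: n_def)
    \<comment> \<open>This single quantity dominates, up to constants, every contribution to the
      logarithmic change per unit of displacement, because \<open>p > 1\<close>,
      \<open>\<tau> \<le> 1\<close> and \<open>V \<ge> 1\<close>.\<close>
    define W where "W = V powr p / \<tau> powr (1 + p)"
    have W: "V / \<tau>\<^sup>2 \<le> W" "1 / \<tau> \<le> W" "0 < W"
    proof -
      have "V powr 1 \<le> V powr p" using V p by (intro powr_mono) auto
      moreover have "\<tau> powr (1 + p) \<le> \<tau> powr 2" using \<tau> p by (intro powr_mono') auto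
      ultimately show 1: "V / \<tau>\<^sup>2 \<le> W"
        unfolding W_def using V \<tau> by (intro frac_le) auto
      have "1 / \<tau> \<le> V / \<tau>\<^sup>2"
        using V \<tau> mult_mono[of 1 V \<tau> 1] by (simp add: field_simps power2_eq_square)
      then show "1 / \<tau> \<le> W" using 1 by simp
      then show "0 < W" using \<tau> by (meson less_le_trans zero_less_divide_1_iff)
    qed
    obtain t where t: "\<tau> / 4 < t" "t < \<tau> / 2" "\<And>i. i \<in> {..<length as} \<Longrightarrow> t \<noteq> cmod (as ! i - w0)"
      "(\<Sum>i\<in>{..<length as}. 1 / \<bar>t - cmod (as ! i - w0)\<bar>) \<le> (3 * p / (p - 1) * real (card {..<length as})) powr p / (\<tau> / 2 - \<tau> / 4)"
      using exists_point_off_poles[of "{..<length as}" "\<tau> / 4" "\<tau> / 2" p "\<lambda>i. cmod (as ! i - w0)"] \<tau> p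
      by auto
    have "G v \<noteq> 0 \<and> cmod (G w) \<le> exp 1 * cmod (G v)"
      if v: "cmod (v - w0) = t" and w: "cmod (w - v) \<le> 1 / M * (\<tau> powr (1 + p) / V powr p)" for v w
    proof -
      have wv: "cmod (w - v) \<le> 1 / (M * W)" using w by (simp add: W_def)
      also have "\<dots> \<le> 1 / (1040 * (1 / \<tau>))"
        using M W \<tau> by (intro divide_left_mono mult_mono) auto
      finally have wv8: "cmod (w - v) \<le> \<tau> / 8" using \<tau> by simp
      have v1: "cmod v \<le> 1 - \<tau> / 2"
      proof -
        have "cmod v \<le> cmod w0 + t" using norm_triangle_ineq[of w0 "v - w0"] v by simp
        moreover have "cmod w0 = 1 - \<tau>" by (simp add: \<tau>_def)
        ultimately show ?thesis using t(2) by linarith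
      qed
      have w1: "cmod w \<le> 1 - 3 * \<tau> / 8"
        using norm_triangle_ineq[of v "w - v"] v1 wv8 by simp
      have vn1: "cmod v < 1" "cmod w < 1" "cmod v \<le> r"
        using v1 w1 \<tau> unfolding r_def by linarith+
      \<comment> \<open>For \<open>v\<close> on the circle of radius \<open>t\<close>, distances to
        zeros are bounded below by differences of radii. The choice of \<open>t\<close> on a real
        interval thus works for all \<open>v\<close> at once.\<close>
      have va: "\<bar>t - cmod (as ! i - w0)\<bar> \<le> cmod (v - as ! i)" for i
      proof -
        have "\<bar>cmod (v - w0) - cmod (as ! i - w0)\<bar> \<le> cmod (v - w0 - (as ! i - w0))"
          by (rule norm_triangle_ineq3)
        then show ?thesis unfolding v by simp
      qed
      have va0: "v \<noteq> a" if a: "a \<in> set as" for a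
      proof -
        obtain i where i: "i < length as" "as ! i = a" using a by (auto simp: in_set_conv_nth)
        have "t \<noteq> cmod (as ! i - w0)" by (rule t(3)) (simp add: i(1))
        then show ?thesis using v unfolding i(2) by metis
      qed
      have "(\<Sum>a\<leftarrow>as. 1 / cmod (v - a)) = (\<Sum>i\<in>{..<length as}. 1 / cmod (v - as ! i))"
        by (simp add: sum_list_sum_nth atLeast0LessThan)
      also have "\<dots> \<le> (\<Sum>i\<in>{..<length as}. 1 / \<bar>t - cmod (as ! i - w0)\<bar>)"
        using va t(3) va0 by (intro sum_mono divide_left_mono) auto
      also have "\<dots> \<le> (K * n) powr p / (\<tau> / 4)" using t(4) by (simp add: K_def n_def)
      also have "\<dots> \<le> (K * (4 * V / \<tau>)) powr p / (\<tau> / 4)"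
        using n K \<tau> p by (intro divide_right_mono powr_mono2 mult_left_mono) auto
      also have "\<dots> = 4 * (4 * K) powr p * W"
        using K V \<tau> by (simp add: W_def powr_mult powr_divide powr_add mult_ac)
      finally have S1: "(\<Sum>a\<leftarrow>as. 1 / cmod (v - a)) \<le> 4 * (4 * K) powr p * W" .
      have "(\<Sum>a\<leftarrow>as. 1 / cmod (v - a) + 1 / (\<tau> / 4)) = (\<Sum>a\<leftarrow>as. 1 / cmod (v - a)) + n * (4 / \<tau>)"
        by (simp add: sum_list_addf sum_list_triv n_def)
      also have "n * (4 / \<tau>) \<le> (4 * V / \<tau>) * (4 / \<tau>)"
        using n \<tau> by (intro mult_right_mono) auto
      also have "\<dots> = 16 * (V / \<tau>\<^sup>2)" by (simp add: power2_eq_square)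
      finally have S2: "(\<Sum>a\<leftarrow>as. 1 / cmod (v - a) + 1 / (\<tau> / 4)) \<le> 4 * (4 * K) powr p * W + 16 * W"
        using S1 W by simp
      have B: "cmod (\<Prod>a\<leftarrow>as. Moebius_function 0 a w)
          \<le> cmod (\<Prod>a\<leftarrow>as. Moebius_function 0 a v) * exp (cmod (w - v) * (\<Sum>a\<leftarrow>as. 1 / cmod (v - a) + 1 / (\<tau> / 4)))"
      proof (rule Blaschke_product_quotient)
        show "cmod w \<le> 1 - \<tau> / 4" using w1 \<tau> by linarith
        show "cmod a < 1 \<and> v \<noteq> a" if "a \<in> set as" for a
          using as(1)[OF that] r va0[OF that] by linarith
      qed (use vn1 \<tau> in auto)
      have gq: "cmod (g w) \<le> cmod (g v) * exp (8 * (V + 1) / (r - (1 - 3 * \<tau> / 8))\<^sup>2 * cmod (w - v))"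
      proof (rule zero_free_quotient_bound)
        show "g holomorphic_on ball 0 r" using g(1) r by (auto intro: holomorphic_on_subset)
        show "exp (- V) \<le> cmod (g 0)" using G0 g0 by simp
      qed (use g r \<tau> v1 w1 in \<open>auto simp: r_def\<close>)
      have "8 * (V + 1) / (r - (1 - 3 * \<tau> / 8))\<^sup>2 = 512 * (V + 1) / \<tau>\<^sup>2"
        using \<tau> by (simp add: r_def field_simps power2_eq_square)
      also have "\<dots> \<le> 1024 * (V / \<tau>\<^sup>2)" using V \<tau> by (simp add: divide_right_mono)
      also have "\<dots> \<le> 1024 * W" using W by simp
      finally have S3: "8 * (V + 1) / (r - (1 - 3 * \<tau> / 8))\<^sup>2 \<le> 1024 * W" .
      have "cmod (w - v) * (\<Sum>a\<leftarrow>as. 1 / cmod (v - a) + 1 / (\<tau> / 4)) + 8 * (V + 1) / (r - (1 - 3 * \<tau> / 8))\<^sup>2 * cmod (w - v)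
          \<le> cmod (w - v) * (M * W)"
        using mult_left_mono[OF S2, of "cmod (w - v)"] mult_left_mono[OF S3, of "cmod (w - v)"]
        by (simp add: M_def algebra_simps)
      also have "\<dots> \<le> 1" using wv W M by (simp add: field_simps)
      finally have le1: "exp (cmod (w - v) * (\<Sum>a\<leftarrow>as. 1 / cmod (v - a) + 1 / (\<tau> / 4)))
          * exp (8 * (V + 1) / (r - (1 - 3 * \<tau> / 8))\<^sup>2 * cmod (w - v)) \<le> exp 1"
        by (simp flip: exp_add)
      have "cmod (G w) = cmod (\<Prod>a\<leftarrow>as. Moebius_function 0 a w) * cmod (g w)"
        using Gg vn1 by (simp add: norm_mult)
      also have "\<dots> \<le> (cmod (\<Prod>a\<leftarrow>as. Moebius_function 0 a v) * exp (cmod (w - v) * (\<Sum>a\<leftarrow>as. 1 / cmod (v - a) + 1 / (\<tau> / 4))))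
          * (cmod (g v) * exp (8 * (V + 1) / (r - (1 - 3 * \<tau> / 8))\<^sup>2 * cmod (w - v)))"
        using B gq by (intro mult_mono) auto
      also have "\<dots> = cmod (G v) * (exp (cmod (w - v) * (\<Sum>a\<leftarrow>as. 1 / cmod (v - a) + 1 / (\<tau> / 4)))
          * exp (8 * (V + 1) / (r - (1 - 3 * \<tau> / 8))\<^sup>2 * cmod (w - v)))"
        using Gg vn1 by (simp add: norm_mult)
      also have "\<dots> \<le> cmod (G v) * exp 1" using le1 by (intro mult_left_mono) auto
      finally have "cmod (G w) \<le> exp 1 * cmod (G v)" by (simp add: mult.commute)
      moreover have "G v \<noteq> 0"
      proof -
        have "Moebius_function 0 a v \<noteq> 0" if "a \<in> set as" for a
          using Blaschke_denominator_nonzero[of a v] as(1)[OF that] r vn1 va0[OF that]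
          by (simp add: Moebius_function_simple)
        then have "(\<Prod>a\<leftarrow>as. Moebius_function 0 a v) \<noteq> 0"
          by (auto simp: prod_list_zero_iff)
        then show ?thesis using Gg g(3) vn1 by simp
      qed
      ultimately show ?thesis by simp
    qed
    then show ?thesis using t unfolding \<tau>_def by blast
  qed
  moreover have "0 < 1 / M" "1 / M \<le> 1 / 16" using M by (auto simp: field_simps)
  ultimately show thesis using that[of "1 / M"] by blast
qed

subsection \<open>A corner domain\<close>

lemma cmod_powr_of_real: "cmod (z powr of_real a) = cmod z powr a"
  by (simp add: norm_powr_real_powr')

text \<open>The argument of \<open>z\<close> is below \<open>pi / 2\<close> in absolute value, so
  that of the power is at most \<open>|a| * pi / 2\<close>, and cosine decreases on
  \<open>[0, pi]\<close>. Negative \<open>a\<close> is allowed because the harmonic majorant uses a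
  negative power.\<close>

lemma Re_powr_right_half_plane:
  assumes "0 < Re z" "\<bar>a\<bar> \<le> 1"
  shows "cos (a * pi / 2) * cmod z powr a \<le> Re (z powr of_real a)"
proof -
  have z0: "z \<noteq> 0" using assms by auto
  have Im: "\<bar>Im (Ln z)\<bar> < pi / 2" using Re_Ln_pos_lt[OF z0] assms by simp
  have "\<bar>a * Im (Ln z)\<bar> \<le> \<bar>a * pi / 2\<bar>"
    using mult_left_mono[OF less_imp_le[OF Im], of "\<bar>a\<bar>"] by (simp add: abs_mult)
  moreover have "\<bar>a * pi / 2\<bar> \<le> pi"
    using mult_right_mono[OF assms(2), of pi] pi_gt_zero by (simp add: abs_mult)
  ultimately have "cos \<bar>a * pi / 2\<bar> \<le> cos \<bar>a * Im (Ln z)\<bar>"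
    by (intro cos_monotone_0_pi_le) auto
  then have "cos (a * pi / 2) \<le> cos (a * Im (Ln z))" by (simp only: cos_abs_real)
  then have "cos (a * pi / 2) * cmod z powr a \<le> cos (a * Im (Ln z)) * cmod z powr a"
    by (rule mult_right_mono) simp
  also have "\<dots> = Re (z powr of_real a)"
    using z0 by (simp add: powr_def Re_exp mult.commute)
  finally show ?thesis .
qed

text \<open>This supplies a lower bound for \<open>f\<close> at the image of the origin under the
  corner map, uniformly over all rotations. Finitely many zeros in a compact disc have finitely many
  moduli, so some annulus avoids them; compactness gives \<open>m\<close>.\<close>

lemma annulus_without_zeros:
  assumes hol: "f holomorphic_on ball 0 1" and nontriv: "\<exists>z\<in>ball 0 1. f z \<noteq> 0"
    and x: "0 \<le> x" "x < 1"
  obtains \<rho>0 \<rho>1 m where "x < \<rho>0" "\<rho>0 < \<rho>1" "\<rho>1 < 1" "0 < m"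
    "\<And>z. \<rho>0 \<le> cmod z \<Longrightarrow> cmod z \<le> \<rho>1 \<Longrightarrow> m \<le> cmod (f z)"
proof -
  define y where "y = (1 + x) / 2"
  have y: "x < y" "y < 1" using x by (auto simp: y_def)
  have "\<exists>l. x \<le> l \<and> l < y \<and> (\<forall>z. l < cmod z \<longrightarrow> cmod z < y \<longrightarrow> f z \<noteq> 0)"
  proof (cases "f constant_on ball 0 1")
    case True
    then obtain c where c: "\<And>z. z \<in> ball 0 1 \<Longrightarrow> f z = c" unfolding constant_on_def by blast
    then have "c \<noteq> 0" using nontriv by auto
    then show ?thesis using c y by (intro exI[of _ x]) auto
  next
    case False
    define Z where "Z = {z \<in> cball 0 y. f z = 0}"
    have "finite Z"
      unfolding Z_def by (rule holomorphic_compact_finite_zeros[OF hol]) (use y False in auto)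
    \<comment> \<open>Including \<open>x\<close> keeps the set nonempty when no zero has modulus in
      the range; above its maximum there are no further zeros below \<open>y\<close>.\<close>
    define M where "M = insert x {t \<in> cmod ` Z. x < t \<and> t < y}"
    have M: "finite M" "M \<noteq> {}" using \<open>finite Z\<close> by (auto simp: M_def)
    show ?thesis
    proof (intro exI[of _ "Max M"] conjI allI impI)
      show "x \<le> Max M" using M by (simp add: M_def)
      show "Max M < y" using M y by (subst Max_less_iff) (auto simp: M_def)
      fix z assume z: "Max M < cmod z" "cmod z < y"
      show "f z \<noteq> 0"
      proof
        assume "f z = 0"
        then have "cmod z \<in> M" using z M by (auto simp: M_def Z_def)
        then show False using Max_ge[OF M(1)] z(1) by force
      qed
    qed
  qed
  then obtain l where l: "x \<le> l" "l < y" and nz: "\<And>z. l < cmod z \<Longrightarrow> cmod z < y \<Longrightarrow> f z \<noteq> 0"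
    by blast
  define \<rho>0 where "\<rho>0 = l + (y - l) / 3"
  define \<rho>1 where "\<rho>1 = l + 2 * (y - l) / 3"
  have \<rho>: "x < \<rho>0" "l < \<rho>0" "\<rho>0 < \<rho>1" "\<rho>1 < y"
    using l by (auto simp: \<rho>0_def \<rho>1_def field_simps)
  define S where "S = cball (0::complex) \<rho>1 - ball 0 \<rho>0"
  have memS: "z \<in> S \<longleftrightarrow> \<rho>0 \<le> cmod z \<and> cmod z \<le> \<rho>1" for z by (auto simp: S_def)
  have "compact S" unfolding S_def by (intro compact_diff) auto
  moreover have "of_real \<rho>0 \<in> S" using \<rho> x by (simp add: memS)
  moreover have "continuous_on S (\<lambda>z. cmod (f z))"
    using \<rho> y by (intro continuous_intros holomorphic_on_imp_continuous_on holomorphic_on_subset[OF hol])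
      (auto simp: memS)
  ultimately obtain u where u: "u \<in> S" "\<And>z. z \<in> S \<Longrightarrow> cmod (f u) \<le> cmod (f z)"
    using continuous_attains_inf[of S "\<lambda>z. cmod (f z)"] by blast
  then have "0 < cmod (f u)" using nz[of u] \<rho> by (auto simp: memS)
  then show thesis using that[of \<rho>0 \<rho>1 "cmod (f u)"] \<rho> y u memS by auto
qed

text \<open>
  The image of the unit disc under \<open>w \<mapsto> 1 - c (1 - w)\<^sup>\<alpha>\<close> touches the unit circle
  only at \<open>1\<close>, and there with a corner of opening less than \<open>\<pi>\<close>.
\<close>
lemma corner_map_bound:
  assumes w: "cmod w < 1" and \<alpha>: "0 < \<alpha>" "\<alpha> \<le> 1" and c: "0 < c" "c \<le> cos (\<alpha> * pi / 2) / 2"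
  shows "cmod (1 - of_real c * (1 - w) powr of_real \<alpha>) \<le> 1 - c * cos (\<alpha> * pi / 2) / 2 * cmod (1 - w) powr \<alpha>"
proof -
  define \<kappa> where "\<kappa> = cos (\<alpha> * pi / 2)"
  have \<kappa>: "0 < \<kappa>" "\<kappa> \<le> 1" "2 * c \<le> \<kappa>" using c by (auto simp: \<kappa>_def)
  define X where "X = (1 - w) powr of_real \<alpha>"
  have "0 < Re (1 - w)" using w complex_Re_le_cmod[of w] by simp
  then have Re: "\<kappa> * cmod X \<le> Re X"
    using Re_powr_right_half_plane[of "1 - w" \<alpha>] \<alpha> by (simp add: X_def \<kappa>_def cmod_powr_of_real)
  have "cmod (1 - w) \<le> 2" using norm_triangle_ineq4[of 1 w] w by simp
  then have "cmod X \<le> 2 powr \<alpha>" using \<alpha> by (simp add: X_def cmod_powr_of_real powr_mono2)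
  also have "\<dots> \<le> 2 powr 1" using \<alpha> by (intro powr_mono) auto
  finally have X2: "cmod X \<le> 2" by simp
  \<comment> \<open>The linear term is at least \<open>2 * c * \<kappa> * |X|\<close> and the
    smallness of \<open>c\<close> makes the quadratic term at most half of that. The surviving half
    is compared with the square of the claimed bound.\<close>
  have "(cmod (1 - of_real c * X))\<^sup>2 = 1 - 2 * c * Re X + c\<^sup>2 * (cmod X)\<^sup>2"
    unfolding cmod_power2[of X] cmod_power2[of "1 - of_real c * X"] by (simp add: power2_eq_square algebra_simps)
  also have "c\<^sup>2 * (cmod X)\<^sup>2 \<le> c * cmod X * \<kappa>"
  proof -
    have "c * cmod X \<le> c * 2" using X2 c by (intro mult_left_mono) auto
    then have "c * cmod X \<le> \<kappa>" using \<kappa>(3) by linarith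
    then have "c * cmod X * (c * cmod X) \<le> c * cmod X * \<kappa>" using c by (intro mult_left_mono) auto
    then show ?thesis by (simp add: power2_eq_square mult_ac)
  qed
  also have "1 - 2 * c * Re X + c * cmod X * \<kappa> \<le> 1 - c * \<kappa> * cmod X"
    using mult_left_mono[OF Re, of c] c by (simp add: algebra_simps)
  also have "\<dots> \<le> (1 - c * \<kappa> / 2 * cmod X)\<^sup>2"
    using zero_le_power2[of "c * \<kappa> / 2 * cmod X"] by (simp add: power2_eq_square algebra_simps)
  finally have "(cmod (1 - of_real c * X))\<^sup>2 \<le> (1 - c * \<kappa> / 2 * cmod X)\<^sup>2" by simp
  moreover have "c * \<kappa> / 2 * cmod X \<le> 1"
  proof -
    have "c * \<kappa> / 2 * cmod X \<le> 1 / 2 * 1 / 2 * 2"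
      using c \<kappa> X2 by (intro mult_mono divide_right_mono) auto
    then show ?thesis by simp
  qed
  ultimately have "cmod (1 - of_real c * X) \<le> 1 - c * \<kappa> / 2 * cmod X"
    using power2_le_imp_le by (metis diff_ge_0_iff_ge)
  then show ?thesis by (simp add: X_def \<kappa>_def cmod_powr_of_real)
qed

text \<open>The base of the inner power has argument below \<open>pi / 2\<close>; because
  \<open>\<alpha> > 1 / 2\<close>, its \<open>1 / \<alpha>\<close>-th power has argument below
  \<open>pi\<close>, so the principal branch of the outer power undoes it.\<close>

lemma corner_map_right_inverse:
  assumes u: "cmod u < 1" and \<alpha>: "1 / 2 < \<alpha>" and c: "0 < c"
  shows "1 - of_real c * (1 - (1 - ((1 - u) / of_real c) powr of_real (1 / \<alpha>))) powr of_real \<alpha> = u"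
proof -
  define x where "x = (1 - u) / of_real c"
  have "0 < Re x" using u c complex_Re_le_cmod[of u] by (simp add: x_def)
  then have "x \<noteq> 0" by auto
  then have x: "x \<noteq> 0" "\<bar>Im (Ln x)\<bar> < pi / 2" using Re_Ln_pos_lt[of x] \<open>0 < Re x\<close> by auto
  have "\<bar>1 / \<alpha> * Im (Ln x)\<bar> < 2 * (pi / 2)"
    unfolding abs_mult using \<alpha> x by (intro mult_strict_mono) (auto simp: field_simps)
  then have "\<bar>Im (of_real (1 / \<alpha>) * Ln x)\<bar> < pi" by simp
  then have "- pi < Im (of_real (1 / \<alpha>) * Ln x)" "Im (of_real (1 / \<alpha>) * Ln x) \<le> pi" by linarith+
  then have "exp (of_real (1 / \<alpha>) * Ln x) powr of_real \<alpha> = exp (of_real (1 / \<alpha>) * Ln x * of_real \<alpha>)"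
    by (rule exp_powr_complex)
  also have "\<dots> = exp (Ln x)" using \<alpha> by simp
  also have "\<dots> = x" using x by simp
  finally have "(x powr of_real (1 / \<alpha>)) powr of_real \<alpha> = x"
    using x by (simp only: powr_def[of x] if_False)
  then show ?thesis using c by (simp add: x_def)
qed

lemma corner_map_left_inverse:
  assumes w: "cmod w < 1" and \<alpha>: "0 < \<alpha>" "\<alpha> \<le> 1" and c: "0 < c"
  shows "1 - ((1 - (1 - of_real c * (1 - w) powr of_real \<alpha>)) / of_real c) powr of_real (1 / \<alpha>) = w"
proof -
  define x where "x = 1 - w"
  have "0 < Re x" using w complex_Re_le_cmod[of w] by (simp add: x_def)
  then have "x \<noteq> 0" by auto
  then have x: "x \<noteq> 0" "\<bar>Im (Ln x)\<bar> < pi / 2" using Re_Ln_pos_lt[of x] \<open>0 < Re x\<close> by auto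
  have "\<bar>\<alpha> * Im (Ln x)\<bar> \<le> 1 * (pi / 2)"
    unfolding abs_mult using \<alpha> x by (intro mult_mono) auto
  then have "\<bar>Im (of_real \<alpha> * Ln x)\<bar> < pi" using pi_gt_zero by (simp del: pi_gt_zero)
  then have "exp (of_real \<alpha> * Ln x) powr of_real (1 / \<alpha>) = exp (of_real \<alpha> * Ln x * of_real (1 / \<alpha>))"
    by (intro exp_powr_complex) auto
  also have "\<dots> = exp (Ln x)" using \<alpha> by simp
  also have "\<dots> = x" using x by simp
  finally have "(x powr of_real \<alpha>) powr of_real (1 / \<alpha>) = x"
    using x by (simp only: powr_def[of x] if_False)
  then show ?thesis using c by (simp add: x_def)
qed

text \<open>The derivative of the inverse contains the exponent \<open>1 / \<alpha> - 1\<close>,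
  which lies between \<open>0\<close> and \<open>1\<close>, while the base has modulus at most
  \<open>2 / c\<close>; hence the derivative is bounded up to the boundary.\<close>

lemma corner_map_inverse_Lipschitz:
  assumes u: "cmod u < 1" "cmod u' < 1" and \<alpha>: "1 / 2 < \<alpha>" "\<alpha> < 1" and c: "0 < c" "c \<le> 1"
  shows "cmod ((1 - ((1 - u) / of_real c) powr of_real (1 / \<alpha>)) - (1 - ((1 - u') / of_real c) powr of_real (1 / \<alpha>)))
    \<le> 4 / c\<^sup>2 * cmod (u - u')"
proof (rule field_differentiable_bound[of "ball 0 1" _
    "\<lambda>u. of_real (1 / \<alpha>) * ((1 - u) / of_real c) powr (of_real (1 / \<alpha>) - 1) / of_real c"])
  fix z :: complex assume z: "z \<in> ball 0 1"
  have "0 < Re ((1 - z) / of_real c)" using z c complex_Re_le_cmod[of z] by simp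
  then have nn: "(1 - z) / of_real c \<notin> \<real>\<^sub>\<le>\<^sub>0" by (auto simp: complex_nonpos_Reals_iff)
  show "((\<lambda>u. 1 - ((1 - u) / of_real c) powr of_real (1 / \<alpha>)) has_field_derivative
      of_real (1 / \<alpha>) * ((1 - z) / of_real c) powr (of_real (1 / \<alpha>) - 1) / of_real c) (at z within ball 0 1)"
    using nn c by (auto intro!: derivative_eq_intros)
  have "cmod ((1 - z) / of_real c) \<le> 2 / c"
    using norm_triangle_ineq4[of 1 z] z c by (simp add: norm_divide divide_right_mono)
  then have "cmod ((1 - z) / of_real c) powr (1 / \<alpha> - 1) \<le> (2 / c) powr (1 / \<alpha> - 1)"
    using \<alpha> by (intro powr_mono2) auto
  also have "\<dots> \<le> (2 / c) powr 1"
    using \<alpha> c by (intro powr_mono) (auto simp: field_simps)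
  finally have b: "cmod ((1 - z) / of_real c) powr (1 / \<alpha> - 1) \<le> 2 / c" using c by simp
  have "cmod (of_real (1 / \<alpha>) * ((1 - z) / of_real c) powr of_real (1 / \<alpha> - 1) / of_real c)
      = (1 / \<alpha>) * cmod ((1 - z) / of_real c) powr (1 / \<alpha> - 1) / c"
    unfolding norm_mult norm_divide cmod_powr_of_real using \<alpha> c by (simp add: norm_divide)
  also have "\<dots> \<le> 2 * (2 / c) / c"
    using \<alpha> c b by (intro divide_right_mono mult_mono) (auto simp: field_simps)
  finally show "cmod (of_real (1 / \<alpha>) * ((1 - z) / of_real c) powr (of_real (1 / \<alpha>) - 1) / of_real c) \<le> 4 / c\<^sup>2"
    by (simp add: power2_eq_square)
qed (use u in auto)

subsection \<open>The logarithmic derivative estimate\<close>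

text \<open>The corner is placed at radius \<open>R = 1 - d\<close>, and \<open>A\<close> is
  estimated at radius \<open>R\<^sup>2\<close>, whose distance to the corner is comparable to
  \<open>d\<close>. Stability of \<open>f\<close> on small discs lets Cauchy's inequality bound the
  quotient of the \<open>k\<close>-th derivative by \<open>f\<close>. The constants depend on
  \<open>f\<close>, but neither on \<open>d\<close> nor on \<open>Q\<close>.\<close>

lemma coefficient_bound_near_circle:
  fixes \<beta> \<epsilon> :: real and k :: nat
  assumes sol: "disc_solution k A f" and nontriv: "nontrivial_on_disc f"
    and anA: "A analytic_on ball 0 1" and \<beta>: "0 < \<beta>" "\<beta> < 1" and \<epsilon>: "0 < \<epsilon>"
  obtains C d0 where "0 < C" "0 < d0" "d0 < 1"
    "\<And>d Q z. \<lbrakk>0 < d; d < d0; 1 \<le> Q;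
      \<And>z. cmod z \<le> 1 - d \<Longrightarrow> cmod (f z) \<le> exp (Q * (1 - cmod z) powr (- \<beta>)); cmod z = (1 - d)\<^sup>2\<rbrakk>
      \<Longrightarrow> cmod (A z) \<le> C * ((Q / d\<^sup>2) powr (1 + \<epsilon>)) ^ k"
proof -
  define p where "p = 1 + \<epsilon>"
  have p: "1 < p" using \<epsilon> by (simp add: p_def)
  \<comment> \<open>This value lies strictly between \<open>1 / 2\<close> and \<open>1\<close> and
    satisfies \<open>(1 + p) / \<alpha> = 2 * p\<close>, so the scale
    \<open>\<tau> powr (1 + p)\<close> becomes exactly \<open>(d / c) powr (2 * p)\<close>.\<close>
  define \<alpha> where "\<alpha> = (1 + p) / (2 * p)"
  have \<alpha>: "1 / 2 < \<alpha>" "\<alpha> < 1" using p by (auto simp: \<alpha>_def field_simps)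
  have holf: "f holomorphic_on ball 0 1"
    using sol by (simp add: disc_solution_def analytic_imp_holomorphic)
  have holA: "A holomorphic_on ball 0 1" using anA by (rule analytic_imp_holomorphic)
  define \<kappa> where "\<kappa> = cos (\<alpha> * pi / 2)"
  have \<kappa>: "0 < \<kappa>" "\<kappa> \<le> 1"
    using \<alpha> by (auto simp: \<kappa>_def intro!: cos_gt_zero)
  obtain \<rho>0 \<rho>1 m where \<rho>: "1 - \<kappa> / 2 < \<rho>0" "\<rho>0 < \<rho>1" "\<rho>1 < 1" and m: "0 < m"
    and fm: "\<And>z. \<rho>0 \<le> cmod z \<Longrightarrow> cmod z \<le> \<rho>1 \<Longrightarrow> m \<le> cmod (f z)"
    using annulus_without_zeros[OF holf, of "1 - \<kappa> / 2"] nontriv \<kappa>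
    unfolding nontrivial_on_disc_def by auto
  \<comment> \<open>With this \<open>c\<close> the origin is sent to modulus
    \<open>R * \<rho>1\<close>, which lies in the zero-free annulus for small \<open>d\<close>.
    Starting the annulus beyond \<open>1 - \<kappa> / 2\<close> makes \<open>c\<close> small enough
    for the corner map.\<close>
  define c where "c = 1 - \<rho>1"
  have c: "0 < c" "c \<le> \<kappa> / 2" "c \<le> 1" using \<rho> \<kappa> by (auto simp: c_def)
  define \<sigma> where "\<sigma> = c * \<kappa> / 2"
  have \<sigma>: "0 < \<sigma>" using c \<kappa> by (simp add: \<sigma>_def)
  define \<gamma> where "\<gamma> = \<alpha> * \<beta>"
  have \<gamma>: "0 < \<gamma>" "\<gamma> < 1" using \<alpha> \<beta> mult_strict_mono[of \<alpha> 1 \<beta> 1] by (auto simp: \<gamma>_def)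
  \<comment> \<open>Dividing by the cosine compensates the loss in the real part of a power, so that
    the real part of \<open>P\<close> dominates the transplanted growth bound.\<close>
  define B where "B = \<sigma> powr (- \<beta>) / cos (\<gamma> * pi / 2)"
  have cos\<gamma>: "0 < cos (\<gamma> * pi / 2)" using \<gamma> by (intro cos_gt_zero) auto
  then have B: "0 < B" using \<sigma> by (simp add: B_def)
  define V0 where "V0 = B + \<bar>ln m\<bar> + 1"
  have V0: "1 \<le> V0" using B by (simp add: V0_def)
  obtain c1 where c1: "0 < c1" "c1 \<le> 1 / 16"
    and stable: "\<And>G V w0. \<lbrakk>G holomorphic_on ball 0 1; \<And>z. cmod z < 1 \<Longrightarrow> cmod (G z) \<le> 1;
      exp (- V) \<le> cmod (G 0); 1 \<le> V; cmod w0 < 1\<rbrakk> \<Longrightarrow>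
      \<exists>t>(1 - cmod w0) / 4. t < (1 - cmod w0) / 2 \<and> (\<forall>v w. cmod (v - w0) = t \<longrightarrow>
        cmod (w - v) \<le> c1 * ((1 - cmod w0) powr (1 + p) / V powr p) \<longrightarrow>
        G v \<noteq> 0 \<and> cmod (G w) \<le> exp 1 * cmod (G v))"
    using bounded_function_stable_on_circle[OF p] by metis
  \<comment> \<open>The first entry keeps discs of radius \<open>s\<close> inside the domain where
    the corner map can be inverted; the second, combined with the Lipschitz constant
    \<open>4 / c\<^sup>2\<close> and a factor \<open>2\<close> from \<open>R \<ge> 1 / 2\<close>,
    keeps their preimages within \<open>c1 * T\<close>.\<close>
  define c2 where "c2 = min (\<sigma> / 8) (c1 * c\<^sup>2 / 8)"
  have c2: "0 < c2" "c2 \<le> \<sigma> / 8" "c2 \<le> c1 * c\<^sup>2 / 8" using \<sigma> c1 c by (auto simp: c2_def)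
  define d0 where "d0 = min c (min (1 - \<rho>0 / \<rho>1) (1 / 2))"
  have \<rho>pos: "0 < \<rho>0" "0 < \<rho>1" using \<rho> \<kappa> by auto
  have "0 < 1 - \<rho>0 / \<rho>1" using \<rho> \<rho>pos by (simp add: field_simps)
  then have d0: "0 < d0" "d0 \<le> c" "d0 \<le> 1 - \<rho>0 / \<rho>1" "d0 \<le> 1 / 2"
    unfolding d0_def using c by (auto simp: min_def)
  define C where "C = fact k * exp 2 * ((V0 * c\<^sup>2) powr p / c2) ^ k"
  have C: "0 < C" unfolding C_def using V0 c c2 by (intro mult_pos_pos zero_less_power divide_pos_pos) auto
  have "cmod (A z0) \<le> C * ((Q / d\<^sup>2) powr (1 + \<epsilon>)) ^ k"
    if d: "0 < d" "d < d0" and Q: "1 \<le> Q"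
      and fb: "\<And>z. cmod z \<le> 1 - d \<Longrightarrow> cmod (f z) \<le> exp (Q * (1 - cmod z) powr (- \<beta>))"
      and z0: "cmod z0 = (1 - d)\<^sup>2" for d Q z0
  proof -
    define R where "R = 1 - d"
    have R: "1 / 2 \<le> R" "R < 1" using d d0 by (auto simp: R_def)
    define \<omega> where "\<omega> = z0 / of_real (R\<^sup>2)"
    have \<omega>: "cmod \<omega> = 1" "z0 = \<omega> * of_real (R\<^sup>2)"
    proof -
      have "cmod (of_real (R\<^sup>2)) = R\<^sup>2" unfolding norm_of_real by simp
      then show "cmod \<omega> = 1" using z0 R by (simp add: \<omega>_def norm_divide R_def)
      show "z0 = \<omega> * of_real (R\<^sup>2)" using R by (simp add: \<omega>_def)
    qed
    \<comment> \<open>Chosen so that \<open>c * \<tau> powr \<alpha> = d\<close>: then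
      \<open>\<psi>\<close> takes \<open>w0 = 1 - \<tau>\<close> to \<open>R\<close>, and
      \<open>\<Phi>\<close> takes it to \<open>z0\<close>.\<close>
    define \<tau> where "\<tau> = (d / c) powr (1 / \<alpha>)"
    have dc: "0 < d / c" "d / c < 1" using d d0 c by (auto simp: field_simps)
    have \<tau>: "0 < \<tau>" "\<tau> < 1"
      using dc \<alpha> powr_less_mono2[of "1 / \<alpha>" "d / c" 1] by (auto simp: \<tau>_def)
    have \<tau>\<alpha>: "c * \<tau> powr \<alpha> = d" using dc \<alpha> c d by (simp add: \<tau>_def powr_powr)
    define V where "V = Q * V0"
    have V: "1 \<le> V" "Q * B \<le> V"
      using Q V0 mult_mono[of 1 Q 1 V0] by (auto simp: V_def V0_def intro!: mult_left_mono)
    define \<psi> where "\<psi> w = 1 - of_real c * (1 - w) powr of_real \<alpha>" for w :: complex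
    define \<Phi> where "\<Phi> w = \<omega> * of_real R * \<psi> w" for w
    have Re1: "0 < Re (1 - w)" if "cmod w < 1" for w
      using that complex_Re_le_cmod[of w] by simp
    have nn: "1 - w \<notin> \<real>\<^sub>\<le>\<^sub>0" if "cmod w < 1" for w
      using Re1[OF that] by (auto simp: complex_nonpos_Reals_iff)
    have hol\<Phi>: "\<Phi> holomorphic_on ball 0 1"
      unfolding \<Phi>_def \<psi>_def by (intro holomorphic_intros) (use nn in auto)
    have \<psi>b: "cmod (\<psi> w) \<le> 1 - \<sigma> * cmod (1 - w) powr \<alpha>" if "cmod w < 1" for w
      using corner_map_bound[OF that, of \<alpha> c] \<alpha> c unfolding \<psi>_def \<sigma>_def \<kappa>_def by simp
    have \<psi>1: "cmod (\<psi> w) \<le> 1" if "cmod w < 1" for w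
      using \<psi>b[OF that] \<sigma> by (smt (verit) mult_nonneg_nonneg powr_ge_zero)
    have \<Phi>n: "cmod (\<Phi> w) = R * cmod (\<psi> w)" for w using \<omega> R by (simp add: \<Phi>_def norm_mult)
    have \<Phi>1: "cmod (\<Phi> w) \<le> R" "cmod (\<Phi> w) < 1" if "cmod w < 1" for w
    proof -
      show "cmod (\<Phi> w) \<le> R" using mult_left_mono[OF \<psi>1[OF that], of R] R by (simp add: \<Phi>n)
      then show "cmod (\<Phi> w) < 1" using R by linarith
    qed
    have maps: "\<Phi> ` ball 0 1 \<subseteq> ball 0 1"
    proof (rule image_subsetI)
      show "\<Phi> w \<in> ball 0 1" if "w \<in> ball 0 1" for w using \<Phi>1(2)[of w] that by simp
    qed
    define P where "P w = of_real (Q * B) * (1 - w) powr of_real (- \<gamma>)" for w :: complex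
    have ReP: "Q * \<sigma> powr (- \<beta>) * cmod (1 - w) powr (- \<gamma>) \<le> Re (P w)" if "cmod w < 1" for w
    proof -
      have "cos (- \<gamma> * pi / 2) * cmod (1 - w) powr (- \<gamma>) \<le> Re ((1 - w) powr of_real (- \<gamma>))"
        using Re_powr_right_half_plane[OF Re1[OF that], of "- \<gamma>"] \<gamma> by auto
      then have "Q * B * (cos (\<gamma> * pi / 2) * cmod (1 - w) powr (- \<gamma>)) \<le> Q * B * Re ((1 - w) powr of_real (- \<gamma>))"
        using Q B by (intro mult_left_mono) auto
      then show ?thesis using cos\<gamma> by (simp add: P_def B_def)
    qed
    have fP: "cmod (f (\<Phi> w)) \<le> exp (Re (P w))" if w: "cmod w < 1" for w
    proof -
      have pos: "0 < cmod (1 - w)" using Re1[OF w] by auto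
      have "\<sigma> * cmod (1 - w) powr \<alpha> \<le> 1 - cmod (\<psi> w)" using \<psi>b[OF w] by simp
      also have "\<dots> \<le> 1 - cmod (\<Phi> w)" using R by (simp add: \<Phi>n mult_left_le_one_le)
      finally have "(1 - cmod (\<Phi> w)) powr (- \<beta>) \<le> (\<sigma> * cmod (1 - w) powr \<alpha>) powr (- \<beta>)"
        using \<beta> \<sigma> pos by (intro powr_mono2') auto
      also have "\<dots> = \<sigma> powr (- \<beta>) * cmod (1 - w) powr (- \<gamma>)"
        using \<sigma> by (simp add: powr_mult powr_powr \<gamma>_def)
      finally have "Q * (1 - cmod (\<Phi> w)) powr (- \<beta>) \<le> Q * (\<sigma> powr (- \<beta>) * cmod (1 - w) powr (- \<gamma>))"
        using Q by (intro mult_left_mono) auto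
      also have "\<dots> \<le> Re (P w)" using ReP[OF w] by (simp add: mult.assoc)
      finally have "Q * (1 - cmod (\<Phi> w)) powr (- \<beta>) \<le> Re (P w)" .
      moreover have "cmod (f (\<Phi> w)) \<le> exp (Q * (1 - cmod (\<Phi> w)) powr (- \<beta>))"
        using fb[of "\<Phi> w"] \<Phi>1[OF w] by (simp add: R_def)
      ultimately show ?thesis by (meson exp_le_cancel_iff order_trans)
    qed
    have holP: "P holomorphic_on ball 0 1"
      unfolding P_def by (intro holomorphic_intros) (use nn in auto)
    define G where "G w = f (\<Phi> w) * exp (- P w)" for w
    have holf\<Phi>: "(\<lambda>w. f (\<Phi> w)) holomorphic_on ball 0 1"
      using holomorphic_on_compose_gen[OF hol\<Phi> holf maps] by (simp add: o_def)
    have holG: "G holomorphic_on ball 0 1"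
      unfolding G_def by (intro holomorphic_intros holf\<Phi> holP)
    have Gn: "cmod (G w) = cmod (f (\<Phi> w)) / exp (Re (P w))" for w
      unfolding G_def norm_mult norm_exp_eq_Re by (simp add: exp_minus divide_inverse)
    have G1: "cmod (G w) \<le> 1" if "cmod w < 1" for w
      using fP[OF that] by (simp add: Gn)
    have G0: "exp (- V) \<le> cmod (G 0)"
    proof -
      have \<Phi>0: "cmod (\<Phi> 0) = R * \<rho>1" using \<rho>pos by (simp add: \<Phi>n \<psi>_def c_def)
      have "\<rho>0 / \<rho>1 \<le> R" using d d0 by (simp add: R_def)
      then have "\<rho>0 \<le> R * \<rho>1" using \<rho>pos by (simp add: field_simps)
      moreover have "R * \<rho>1 \<le> \<rho>1" using R \<rho>pos by (simp add: mult_left_le_one_le)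
      ultimately have "m \<le> cmod (f (\<Phi> 0))" using fm[of "\<Phi> 0"] by (simp add: \<Phi>0)
      then have "m * exp (- (Q * B)) \<le> cmod (G 0)"
        by (simp add: Gn P_def exp_minus divide_inverse)
      moreover have "- V \<le> ln m + - (Q * B)"
      proof -
        have "\<bar>ln m\<bar> + 1 \<le> Q * (\<bar>ln m\<bar> + 1)" using Q by (simp add: mult_le_cancel_right1)
        then show ?thesis by (simp add: V_def V0_def algebra_simps)
      qed
      then have "exp (- V) \<le> exp (ln m + - (Q * B))" by (simp only: exp_le_cancel_iff)
      ultimately show ?thesis using m by (simp only: exp_add exp_ln)
    qed
    define w0 where "w0 = complex_of_real (1 - \<tau>)"
    have w0: "cmod w0 = 1 - \<tau>" unfolding w0_def norm_of_real using \<tau> by simp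
    define T where "T = \<tau> powr (1 + p) / V powr p"
    obtain t where t: "\<tau> / 4 < t" "t < \<tau> / 2"
      and st: "\<And>v w. cmod (v - w0) = t \<Longrightarrow> cmod (w - v) \<le> c1 * T \<Longrightarrow>
        G v \<noteq> 0 \<and> cmod (G w) \<le> exp 1 * cmod (G v)"
      using stable[OF holG G1 G0 V(1), of w0] w0 \<tau> unfolding T_def by auto
    have T: "0 < T" "T \<le> \<tau>" "V / \<tau>\<^sup>2 * T \<le> 1"
    proof -
      show "0 < T" using \<tau> V by (simp add: T_def)
      have "1 \<le> V powr p" using V p by (simp add: ge_one_powr_ge_zero)
      moreover have "\<tau> powr (1 + p) \<le> \<tau> powr 1" using \<tau> p by (intro powr_mono') auto
      ultimately have "T \<le> \<tau> powr 1 / 1" unfolding T_def using \<tau> by (intro frac_le) auto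
      then show "T \<le> \<tau>" using \<tau> by simp
      have "V powr 1 \<le> V powr p" using V p by (intro powr_mono) auto
      moreover have "\<tau> powr (1 + p) \<le> \<tau> powr 2" using \<tau> p by (intro powr_mono') auto
      ultimately have "T \<le> \<tau> powr 2 / V powr 1" unfolding T_def using \<tau> V by (intro frac_le) auto
      then show "V / \<tau>\<^sup>2 * T \<le> 1" using \<tau> V by (simp add: field_simps)
    qed
    define s where "s = c2 * T"
    have s: "0 < s" using c2 T by (simp add: s_def)
    \<comment> \<open>Pull a point near \<open>\<Phi> v\<close> back through the corner map to a
      point \<open>w\<close> near \<open>v\<close>. The ratio of the values of \<open>f\<close> is
      the ratio for \<open>G\<close> times \<open>exp (Re (P w) - Re (P v))\<close>, and each
      contributes at most one factor \<open>exp 1\<close>.\<close>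
    have loc: "cmod (f z') \<le> exp 2 * cmod (f (\<Phi> v)) \<and> cmod z' < 1 \<and> f (\<Phi> v) \<noteq> 0"
      if v: "cmod (v - w0) = t" and z': "cmod (z' - \<Phi> v) \<le> s" for v z'
    proof -
      have v1: "cmod v \<le> 1 - \<tau> / 2"
        using norm_triangle_ineq[of w0 "v - w0"] v t(2) w0 by (simp add: algebra_simps)
      have vlt: "cmod v < 1" using v1 \<tau> by linarith
      define u' where "u' = z' / (\<omega> * of_real R)"
      have \<omega>0: "\<omega> * of_real R \<noteq> 0" using \<omega> R by auto
      have z'u: "z' = \<omega> * of_real R * u'" using \<omega>0 by (simp add: u'_def)
      have "z' - \<Phi> v = \<omega> * of_real R * (u' - \<psi> v)" by (simp add: z'u \<Phi>_def algebra_simps)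
      then have "R * cmod (u' - \<psi> v) \<le> s" using z' \<omega> R by (simp add: norm_mult)
      then have "1 / 2 * cmod (u' - \<psi> v) \<le> s"
        using mult_right_mono[OF R(1), of "cmod (u' - \<psi> v)"] by simp
      then have u\<psi>: "cmod (u' - \<psi> v) \<le> 2 * s" by simp
      have "\<tau> / 2 \<le> cmod (1 - v)" using norm_triangle_ineq2[of 1 v] v1 by simp
      then have "(\<tau> / 2) powr \<alpha> \<le> cmod (1 - v) powr \<alpha>" using \<alpha> \<tau> by (intro powr_mono2) auto
      moreover have "(\<tau> / 2) powr 1 \<le> (\<tau> / 2) powr \<alpha>" using \<alpha> \<tau> by (intro powr_mono') auto
      ultimately have "\<tau> / 2 \<le> cmod (1 - v) powr \<alpha>" using \<tau> by simp
      then have "\<sigma> * (\<tau> / 2) \<le> \<sigma> * cmod (1 - v) powr \<alpha>" using \<sigma> by (intro mult_left_mono) auto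
      moreover have "s \<le> \<sigma> / 8 * \<tau>" unfolding s_def using c2 T \<sigma> by (intro mult_mono) auto
      moreover have "cmod u' \<le> cmod (\<psi> v) + cmod (u' - \<psi> v)"
        using norm_triangle_ineq[of "\<psi> v" "u' - \<psi> v"] by simp
      moreover have "0 < \<sigma> * \<tau>" using \<sigma> \<tau> by simp
      ultimately have u'1: "cmod u' < 1" "cmod (\<psi> v) < 1"
        using \<psi>b[OF vlt] u\<psi> s by auto
      define w where "w = 1 - ((1 - u') / of_real c) powr of_real (1 / \<alpha>)"
      have \<psi>w: "\<psi> w = u'"
        unfolding \<psi>_def w_def using corner_map_right_inverse[OF u'1(1), of \<alpha> c] \<alpha> c by simp
      have \<Phi>w: "\<Phi> w = z'" by (simp add: \<Phi>_def \<psi>w z'u)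
      have v_eq: "1 - ((1 - \<psi> v) / of_real c) powr of_real (1 / \<alpha>) = v"
        unfolding \<psi>_def using corner_map_left_inverse[OF vlt, of \<alpha> c] \<alpha> c by simp
      have "cmod (w - v) \<le> 4 / c\<^sup>2 * cmod (u' - \<psi> v)"
        using corner_map_inverse_Lipschitz[OF u'1, of \<alpha> c] \<alpha> c unfolding v_eq by (simp add: w_def)
      also have "\<dots> \<le> 4 / c\<^sup>2 * (2 * s)" using u\<psi> by (intro mult_left_mono) auto
      also have "\<dots> = 8 / c\<^sup>2 * c2 * T" by (simp add: s_def)
      also have "\<dots> \<le> 8 / c\<^sup>2 * (c1 * c\<^sup>2 / 8) * T"
        using c2 T by (intro mult_right_mono mult_left_mono) auto
      also have "\<dots> = c1 * T" using c by simp
      finally have wv: "cmod (w - v) \<le> c1 * T" .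
      have GG: "G v \<noteq> 0" "cmod (G w) \<le> exp 1 * cmod (G v)" using st[OF v wv] by auto
      have "c1 * T \<le> 1 / 16 * T" using c1 T by (intro mult_right_mono) auto
      then have wv16: "cmod (w - v) \<le> T / 16" using wv by simp
      have w1: "cmod w \<le> 1 - \<tau> / 4"
        using norm_triangle_ineq[of v "w - v"] wv16 T(2) v1 \<tau> by (simp add: algebra_simps)
      \<comment> \<open>On the disc of radius \<open>1 - \<tau> / 4\<close> the derivative of
        \<open>P\<close> is \<open>O(V / \<tau>\<^sup>2)\<close>, while \<open>T\<close> was seen to
        be at most \<open>\<tau>\<^sup>2 / V\<close>; so \<open>P\<close> changes by at most
        \<open>1\<close>.\<close>
      have "cmod (P w - P v) \<le> 16 * V / \<tau>\<^sup>2 * cmod (w - v)"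
      proof (rule field_differentiable_bound[of "cball 0 (1 - \<tau> / 4)" P
            "\<lambda>w. of_real (Q * B) * (of_real \<gamma> * (1 - w) powr of_real (- \<gamma> - 1))"])
        fix x assume x: "x \<in> cball (0::complex) (1 - \<tau> / 4)"
        then have xlt: "cmod x < 1" using \<tau> by simp
        show "(P has_field_derivative of_real (Q * B) * (of_real \<gamma> * (1 - x) powr of_real (- \<gamma> - 1)))
            (at x within cball 0 (1 - \<tau> / 4))"
          unfolding P_def using nn[OF xlt] by (auto intro!: derivative_eq_intros)
        have "\<tau> / 4 \<le> cmod (1 - x)" using norm_triangle_ineq2[of 1 x] x by simp
        then have "cmod (1 - x) powr (- \<gamma> - 1) \<le> (\<tau> / 4) powr (- \<gamma> - 1)"
          using \<gamma> \<tau> by (intro powr_mono2') auto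
        also have "\<dots> \<le> (\<tau> / 4) powr (- 2)" using \<gamma> \<tau> by (intro powr_mono') auto
        also have "\<dots> = 16 / \<tau>\<^sup>2" using \<tau> by (simp add: powr_minus_divide power2_eq_square)
        finally have "cmod (1 - x) powr (- \<gamma> - 1) \<le> 16 / \<tau>\<^sup>2" .
        then have "(Q * B) * (\<gamma> * cmod (1 - x) powr (- \<gamma> - 1)) \<le> V * (1 * (16 / \<tau>\<^sup>2))"
          using V Q B \<gamma> by (intro mult_mono) auto
        moreover have "cmod (of_real (Q * B) * (of_real \<gamma> * (1 - x) powr of_real (- \<gamma> - 1)))
            = (Q * B) * (\<gamma> * cmod (1 - x) powr (- \<gamma> - 1))"
          unfolding norm_mult cmod_powr_of_real norm_of_real using Q B \<gamma> by simp
        ultimately show "cmod (of_real (Q * B) * (of_real \<gamma> * (1 - x) powr of_real (- \<gamma> - 1))) \<le> 16 * V / \<tau>\<^sup>2"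
          by (simp add: mult_ac)
      qed (use w1 v1 \<tau> in auto)
      also have "\<dots> \<le> 16 * V / \<tau>\<^sup>2 * (T / 16)" using wv16 V by (intro mult_left_mono) auto
      also have "\<dots> \<le> 1" using T(3) by simp
      finally have Pwv: "Re (P w) \<le> 1 + Re (P v)"
        using complex_Re_le_cmod[of "P w - P v"] by simp
      have fG: "cmod (f (\<Phi> x)) = cmod (G x) * exp (Re (P x))" for x by (simp add: Gn)
      have "cmod (f z') = cmod (G w) * exp (Re (P w))" using fG[of w] \<Phi>w by simp
      also have "\<dots> \<le> (exp 1 * cmod (G v)) * exp (1 + Re (P v))"
        using GG Pwv by (intro mult_mono) auto
      also have "\<dots> = (exp 1 * exp 1) * (cmod (G v) * exp (Re (P v)))"
        by (simp only: exp_add mult_ac)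
      also have "\<dots> = exp 2 * cmod (f (\<Phi> v))" unfolding fG by (simp flip: exp_add)
      finally have "cmod (f z') \<le> exp 2 * cmod (f (\<Phi> v))" .
      moreover have "f (\<Phi> v) \<noteq> 0" using GG(1) by (auto simp: G_def)
      moreover have "cmod z' < 1" using \<Phi>1(2)[of w] w1 \<tau> \<Phi>w by simp
      ultimately show ?thesis by simp
    qed
    have Ab: "cmod (A (\<Phi> v)) \<le> fact k * exp 2 / s ^ k" if v: "cmod (v - w0) = t" for v
    proof -
      have sub: "cball (\<Phi> v) s \<subseteq> ball 0 1"
        using loc[OF v] by (auto simp: dist_norm norm_minus_commute)
      have "cmod ((deriv ^^ k) f (\<Phi> v)) \<le> fact k * (exp 2 * cmod (f (\<Phi> v))) / s ^ k"
      proof (rule Cauchy_inequality)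
        show "f holomorphic_on ball (\<Phi> v) s"
          using sub holf by (meson ball_subset_cball holomorphic_on_subset subset_trans)
        show "continuous_on (cball (\<Phi> v) s) f"
          using sub holf by (meson holomorphic_on_imp_continuous_on holomorphic_on_subset)
      qed (use s loc[OF v] in \<open>auto simp: norm_minus_commute\<close>)
      moreover have in1: "\<Phi> v \<in> ball 0 1" using sub s by (meson centre_in_cball less_imp_le subsetD)
      then have "(deriv ^^ k) f (\<Phi> v) = - (A (\<Phi> v) * f (\<Phi> v))"
        using sol unfolding disc_solution_def by (metis add_eq_0_iff2)
      ultimately have "cmod (A (\<Phi> v)) * cmod (f (\<Phi> v)) \<le> (fact k * exp 2 / s ^ k) * cmod (f (\<Phi> v))"
        by (simp add: norm_mult mult_ac)
      moreover have "0 < cmod (f (\<Phi> v))" using loc[OF v, of "\<Phi> v"] s by simp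
      ultimately show ?thesis by (simp only: mult_le_cancel_right_pos)
    qed
    have holA\<Phi>: "(\<lambda>w. A (\<Phi> w)) holomorphic_on ball 0 1"
      using holomorphic_on_compose_gen[OF hol\<Phi> holA maps] by (simp add: o_def)
    have sub: "cball w0 t \<subseteq> ball 0 1"
    proof
      fix x assume "x \<in> cball w0 t"
      then have "cmod (x - w0) \<le> t" by (simp add: dist_norm norm_minus_commute)
      then have "cmod x \<le> 1 - \<tau> + t" using norm_triangle_ineq[of w0 "x - w0"] w0 by simp
      then have "cmod x < 1" using t \<tau> by linarith
      then show "x \<in> ball 0 1" by simp
    qed
    \<comment> \<open>Order zero of Cauchy's inequality acts as the maximum principle: the bound for
      \<open>A\<close> passes from the zero-avoiding circle to its centre, where \<open>f\<close>
      may vanish.\<close>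
    have "cmod ((deriv ^^ 0) (\<lambda>w. A (\<Phi> w)) w0) \<le> fact 0 * (fact k * exp 2 / s ^ k) / t ^ 0"
    proof (rule Cauchy_inequality)
      show "(\<lambda>w. A (\<Phi> w)) holomorphic_on ball w0 t"
        using sub holA\<Phi> by (meson ball_subset_cball holomorphic_on_subset subset_trans)
      show "continuous_on (cball w0 t) (\<lambda>w. A (\<Phi> w))"
        using sub holA\<Phi> by (meson holomorphic_on_imp_continuous_on holomorphic_on_subset)
      show "0 < t" using t \<tau> by linarith
    qed (use Ab in \<open>simp add: norm_minus_commute\<close>)
    then have "cmod (A (\<Phi> w0)) \<le> fact k * exp 2 / s ^ k" by simp
    moreover have "\<Phi> w0 = z0"
    proof -
      have "(1 - w0) powr of_real \<alpha> = complex_of_real (\<tau> powr \<alpha>)"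
        using \<tau> powr_of_real[of \<tau> \<alpha>] by (simp add: w0_def)
      then have "\<psi> w0 = of_real (1 - c * \<tau> powr \<alpha>)" by (simp add: \<psi>_def)
      then have "\<psi> w0 = of_real R" by (simp add: \<tau>\<alpha> R_def)
      then show ?thesis using \<omega>(2) by (simp add: \<Phi>_def power2_eq_square)
    qed
    moreover have "fact k * exp 2 / s ^ k = C * ((Q / d\<^sup>2) powr (1 + \<epsilon>)) ^ k"
    proof -
      have "\<tau> powr (1 + p) = (d / c) powr (2 * p)"
        using p by (simp add: \<tau>_def powr_powr \<alpha>_def)
      also have "\<dots> = ((d / c) powr 2) powr p" by (simp add: powr_powr)
      also have "(d / c) powr 2 = (d / c)\<^sup>2" using dc by simp
      finally have "T = ((d / c)\<^sup>2 / V) powr p" using V by (simp add: T_def powr_divide)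
      also have "\<dots> = (1 / (V0 * c\<^sup>2 * (Q / d\<^sup>2))) powr p" using Q d c by (simp add: V_def field_simps)
      also have "\<dots> = 1 / ((V0 * c\<^sup>2) powr p * (Q / d\<^sup>2) powr p)"
        using V0 Q by (simp add: powr_divide powr_mult)
      finally have "1 / s = (V0 * c\<^sup>2) powr p / c2 * (Q / d\<^sup>2) powr p" by (simp add: s_def)
      then have "(1 / s) ^ k = ((V0 * c\<^sup>2) powr p / c2) ^ k * ((Q / d\<^sup>2) powr p) ^ k"
        by (simp only: power_mult_distrib)
      moreover have "fact k * exp 2 / s ^ k = fact k * exp 2 * (1 / s) ^ k" by (simp add: power_one_over)
      ultimately show ?thesis by (simp only: C_def p_def mult.assoc)
    qed
    ultimately show ?thesis by simp
  qed
  then show thesis using that[of C d0] C d0 by simp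
qed

subsection \<open>Growth of solutions\<close>

text \<open>
  Along a ray, \<open>K H\<^sup>j E\<close> with \<open>E' = H E\<close> and \<open>H\<close> increasing dominates the \<open>j\<close>-th derivative of the
  solution for all \<open>j < k\<close> simultaneously; consider the first point where this fails.
\<close>
lemma solution_majorant:
  assumes sol: "disc_solution k A f" and k: "1 \<le> k" and \<delta>: "0 \<le> \<delta>" "\<delta> \<le> 1" and q: "1 < q"
    and C: "2 powr q \<le> C" and r: "r < 1"
    and Ab: "\<And>z. cmod z \<le> r \<Longrightarrow> cmod (A z) \<le> (C * (1 + \<delta> - cmod z) powr (- q)) ^ k"
    and z: "cmod z \<le> r"
  shows "cmod (f z) \<le> (1 + (\<Sum>j<k. cmod ((deriv ^^ j) f 0))) * exp (C / (q - 1) * (1 + \<delta> - cmod z) powr (1 - q))"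
proof -
  define K where "K = 1 + (\<Sum>j<k. cmod ((deriv ^^ j) f 0))"
  have Kj: "cmod ((deriv ^^ j) f 0) < K" if "j < k" for j
    using member_le_sum[of j "{..<k}" "\<lambda>j. cmod ((deriv ^^ j) f 0)"] that by (simp add: K_def)
  have K: "1 \<le> K" by (auto simp: K_def intro: sum_nonneg)
  have holf: "f holomorphic_on ball 0 1"
    using sol by (simp add: disc_solution_def analytic_imp_holomorphic)
  obtain \<omega> where \<omega>: "cmod \<omega> = 1" "z = of_real (cmod z) * \<omega>"
  proof (cases "z = 0")
    case True then show ?thesis using that[of 1] by simp
  next
    case False then show ?thesis using that[of "z / of_real (cmod z)"] by (simp add: norm_divide)
  qed
  have r0: "0 \<le> r" using z norm_ge_zero[of z] by linarith
  have C1: "1 \<le> C" using C q by (meson ge_one_powr_ge_zero less_eq_real_def one_le_numeral order_trans zero_le_one)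
  define H where "H s = C * (1 + \<delta> - s) powr (- q)" for s
  define E where "E s = exp (C / (q - 1) * (1 + \<delta> - s) powr (1 - q))" for s
  define g where "g j s = (deriv ^^ j) f (of_real s * \<omega>)" for j and s :: real
  define u where "u j s = K * (H s ^ j * E s)" for j s
  \<comment> \<open>This is the derivative of \<open>u j\<close>. Its first summand, from
    differentiating \<open>H ^ j\<close>, is nonnegative; its second is
    \<open>u (Suc j)\<close>.\<close>
  define u' where "u' j s = K * (real j * (C * q * (1 + \<delta> - s) powr (- q - 1)) * H s ^ (j - 1) * E s + H s ^ j * (H s * E s))" for j s
  have pos: "0 < 1 + \<delta> - s" if "s \<le> r" for s using that r \<delta> by linarith
  have Hnn: "0 \<le> H s" for s using C1 by (simp add: H_def)
  have E1: "1 \<le> E s" for s using C1 q by (simp add: E_def)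
  have derH: "(H has_real_derivative C * q * (1 + \<delta> - s) powr (- q - 1)) (at s)" if "s \<le> r" for s
    unfolding H_def using pos[OF that] by (auto intro!: derivative_eq_intros)
  have derE: "(E has_real_derivative H s * E s) (at s)" if "s \<le> r" for s
  proof -
    have "((\<lambda>s. C / (q - 1) * (1 + \<delta> - s) powr (1 - q)) has_real_derivative
        C / (q - 1) * ((1 - q) * (1 + \<delta> - s) powr (1 - q - 1) * (- 1))) (at s)"
      using pos[OF that] q by (auto intro!: derivative_eq_intros)
    also have "C / (q - 1) * ((1 - q) * (1 + \<delta> - s) powr (1 - q - 1) * (- 1)) = H s"
    proof -
      have "C / (q - 1) * ((1 - q) * y * (- 1)) = C * y" for y using q by (simp add: field_simps)
      then show ?thesis by (simp add: H_def)
    qed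
    finally show ?thesis
      unfolding E_def by (rule DERIV_fun_exp[THEN DERIV_cong]) (rule mult.commute)
  qed
  have der_u: "(u j has_real_derivative u' j s) (at s)" if "s \<le> r" for j s
    unfolding u_def u'_def
    by (rule derivative_eq_intros refl derH[OF that] derE[OF that])+ (simp add: algebra_simps)
  have u_next: "u (Suc j) s \<le> u' j s" for j s
  proof -
    have "0 \<le> real j * (C * q * (1 + \<delta> - s) powr (- q - 1)) * H s ^ (j - 1) * E s"
      using C1 q Hnn E1[of s] by simp
    then show ?thesis unfolding u_def u'_def using K by (intro mult_left_mono) (auto simp: mult_ac)
  qed
  have in_ball: "of_real s * \<omega> \<in> ball 0 1" if "0 \<le> s" "s \<le> r" for s
    using that r \<omega> by (simp add: norm_mult)
  have der_g: "(g j has_vector_derivative \<omega> * g (Suc j) s) (at s)" if "0 \<le> s" "s \<le> r" for j s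
  proof -
    have "((deriv ^^ j) f has_field_derivative (deriv ^^ Suc j) f (of_real s * \<omega>)) (at (of_real s * \<omega>))"
      using holomorphic_derivI[OF holomorphic_higher_deriv[OF holf] _ in_ball[OF that]] by simp
    moreover have "((\<lambda>s. of_real s * \<omega>) has_vector_derivative \<omega>) (at s)"
      by (auto intro!: derivative_eq_intros)
    ultimately show ?thesis
      unfolding g_def using field_vector_diff_chain_at[of "\<lambda>s. of_real s * \<omega>" \<omega> s "(deriv ^^ j) f"]
      by (simp add: o_def)
  qed
  have cont_g: "continuous_on {0..r} (g j)" for j
  proof (rule continuous_at_imp_continuous_on, rule ballI)
    show "isCont (g j) s" if "s \<in> {0..r}" for s
      by (rule has_vector_derivative_continuous[OF der_g]) (use that in auto)
  qed
  have cont_u: "continuous_on {0..r} (u j)" for j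
  proof (rule continuous_at_imp_continuous_on, rule ballI)
    show "isCont (u j) s" if "s \<in> {0..r}" for s
      by (rule DERIV_isCont[OF der_u]) (use that in auto)
  qed
  define S where "S = (\<Union>j<k. {s \<in> {0..r}. u j s \<le> cmod (g j s)})"
  have "S = {}"
  proof (rule ccontr)
    assume ne: "S \<noteq> {}"
    have closed: "closed S"
      unfolding S_def
    proof (intro closed_UN ballI)
      show "closed {s \<in> {0..r}. u j s \<le> cmod (g j s)}" for j
        by (rule continuous_on_closed_Collect_le) (auto intro!: cont_u continuous_on_norm cont_g)
    qed simp
    have bdd: "bdd_below S" by (rule bdd_belowI[of _ 0]) (auto simp: S_def)
    define s where "s = Inf S"
    have sS: "s \<in> S" unfolding s_def by (rule closed_contains_Inf[OF ne bdd closed])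
    then obtain j where j: "j < k" "0 \<le> s" "s \<le> r" "u j s \<le> cmod (g j s)" by (auto simp: S_def)
    have below: "cmod (g i x) < u i x" if "i < k" "0 \<le> x" "x < s" for i x
    proof (rule ccontr)
      assume "\<not> ?thesis"
      then have "x \<in> S" using that j by (force simp: S_def)
      then show False using cInf_lower[OF _ bdd, of x] that by (simp add: s_def)
    qed
    \<comment> \<open>The condition \<open>2 powr q \<le> C\<close> gives
      \<open>H 0 \<ge> 1\<close>, so every \<open>u j 0\<close> is at least \<open>K\<close>, which
      strictly exceeds all initial derivatives.\<close>
    have start: "cmod (g j 0) < u j 0"
    proof -
      have "(1 + \<delta>) powr q \<le> 2 powr q" using \<delta> q by (intro powr_mono2) auto
      then have "(1 + \<delta>) powr q \<le> C" using C by simp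
      then have "1 \<le> H 0" using \<delta> by (simp add: H_def powr_minus_divide field_simps)
      then have "K * (1 * 1) \<le> u j 0"
        unfolding u_def using K E1 by (intro mult_left_mono mult_mono one_le_power) auto
      then show ?thesis using Kj[OF j(1)] by (simp add: g_def)
    qed
    have "s \<noteq> 0" using start j by auto
    then have s0: "0 < s" using j by simp
    have "cmod (g j s - g j 0) \<le> u j s - u j 0"
    proof (rule differentiable_bound_general[OF s0])
      show "continuous_on {0..s} (g j)" "continuous_on {0..s} (u j)"
        by (rule continuous_on_subset[OF cont_g] continuous_on_subset[OF cont_u]; use j in simp)+
      fix x assume x: "0 < x" "x < s"
      show "(g j has_vector_derivative \<omega> * g (Suc j) x) (at x)" using x j by (intro der_g) auto
      show "(u j has_vector_derivative u' j x) (at x)"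
        using der_u[of x j] x j by (simp add: has_real_derivative_iff_has_vector_derivative)
      \<comment> \<open>The differential equation closes the system: for \<open>Suc j = k\<close> it
        bounds the top derivative by \<open>H ^ k * u 0 = u k\<close>; otherwise the comparison
        before the first failure applies.\<close>
      have "cmod (g (Suc j) x) \<le> u (Suc j) x"
      proof (cases "Suc j = k")
        case True
        have nx: "cmod (of_real x * \<omega>) = x" using x \<omega> by (simp add: norm_mult)
        have "(deriv ^^ k) f (of_real x * \<omega>) = - (A (of_real x * \<omega>) * f (of_real x * \<omega>))"
          using sol in_ball[of x] x j unfolding disc_solution_def by (metis add_eq_0_iff2 less_imp_le order_trans)
        then have "cmod (g k x) = cmod (A (of_real x * \<omega>)) * cmod (g 0 x)"
          by (simp add: g_def norm_mult)
        also have "\<dots> \<le> H x ^ k * u 0 x"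
        proof (rule mult_mono)
          show "cmod (A (of_real x * \<omega>)) \<le> H x ^ k"
            using Ab[of "of_real x * \<omega>"] x j nx by (simp add: H_def)
          show "cmod (g 0 x) \<le> u 0 x" using below[of 0 x] x k by simp
        qed (use Hnn in auto)
        finally show ?thesis by (simp add: True u_def mult_ac)
      next
        case False
        then show ?thesis using below[of "Suc j" x] j x by simp
      qed
      then show "cmod (\<omega> * g (Suc j) x) \<le> u' j x"
        using u_next[of j x] \<omega> by (simp add: norm_mult)
    qed
    moreover have "cmod (g j s) \<le> cmod (g j 0) + cmod (g j s - g j 0)"
      using norm_triangle_ineq[of "g j 0" "g j s - g j 0"] by simp
    ultimately show False using start j by linarith
  qed
  moreover have "cmod z \<in> {0..r}" using z by simp
  ultimately have "\<not> u 0 (cmod z) \<le> cmod (g 0 (cmod z))" using k by (auto simp: S_def)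
  then show ?thesis using \<omega>(2) by (simp add: u_def g_def K_def E_def)
qed

text \<open>Taking \<open>k\<close>-th roots turns the coefficient exponent \<open>s\<close> into
  \<open>q = s / k\<close>. The constant is chosen before \<open>\<delta>\<close> and
  \<open>r\<close>, which allows \<open>\<delta>\<close> to vary with the radius.\<close>

lemma solution_growth:
  assumes sol: "disc_solution k A f" and k: "1 \<le> k" and s: "real k < s" and C0: "1 \<le> C0"
  obtains C where "1 \<le> C" "\<And>\<delta> r z. \<lbrakk>0 \<le> \<delta>; \<delta> \<le> 1; r < 1;
      \<And>z. cmod z \<le> r \<Longrightarrow> cmod (A z) \<le> C0 * (1 + \<delta> - cmod z) powr (- s); cmod z \<le> r\<rbrakk>
      \<Longrightarrow> cmod (f z) \<le> exp (C * (1 + \<delta> - cmod z) powr (- (s / real k - 1)))"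
proof -
  define q where "q = s / real k"
  have q: "1 < q" "q * real k = s" using s k by (auto simp: q_def)
  define C1 where "C1 = max (2 powr q) C0"
  have C1: "2 powr q \<le> C1" "C0 \<le> C1" "1 \<le> C1" using C0 by (auto simp: C1_def)
  define K where "K = 1 + (\<Sum>j<k. cmod ((deriv ^^ j) f 0))"
  have K: "1 \<le> K" by (auto simp: K_def intro: sum_nonneg)
  \<comment> \<open>The middle summand absorbs the factor \<open>K\<close>, since
    \<open>1 \<le> 2 powr (q - 1) * x powr (- (q - 1))\<close> for \<open>0 < x \<le> 2\<close>; the
    last is the exponent of the majorant.\<close>
  define C where "C = 1 + ln K * 2 powr (q - 1) + C1 / (q - 1)"
  have C: "1 \<le> C" using K C1 q by (simp add: C_def)
  have "cmod (f z) \<le> exp (C * (1 + \<delta> - cmod z) powr (- (s / real k - 1)))"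
    if \<delta>: "0 \<le> \<delta>" "\<delta> \<le> 1" and r: "r < 1"
      and Ab: "\<And>z. cmod z \<le> r \<Longrightarrow> cmod (A z) \<le> C0 * (1 + \<delta> - cmod z) powr (- s)"
      and z: "cmod z \<le> r" for \<delta> r z
  proof -
    have 1: "cmod (f z) \<le> K * exp (C1 / (q - 1) * (1 + \<delta> - cmod z) powr (1 - q))"
      unfolding K_def
    proof (rule solution_majorant[OF sol k \<delta> q(1) C1(1) r _ z])
      fix z assume z: "cmod z \<le> r"
      have "cmod (A z) \<le> C0 * (1 + \<delta> - cmod z) powr (- s)" by (rule Ab[OF z])
      also have "\<dots> \<le> C1 ^ k * (1 + \<delta> - cmod z) powr (- s)"
        using C1 self_le_power[of C1 k] k by (intro mult_right_mono) auto
      also have "(1 + \<delta> - cmod z) powr (- s) = ((1 + \<delta> - cmod z) powr (- q)) ^ k"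
        using q z r \<delta> by (simp add: powr_realpow[symmetric] powr_powr)
      finally show "cmod (A z) \<le> (C1 * (1 + \<delta> - cmod z) powr (- q)) ^ k"
        by (simp add: power_mult_distrib)
    qed
    define x where "x = 1 + \<delta> - cmod z"
    have x: "0 < x" "x \<le> 2" using z r \<delta> norm_ge_zero[of z] unfolding x_def by linarith+
    define Y where "Y = x powr (- (q - 1))"
    have "ln K * 1 \<le> ln K * (2 powr (q - 1) * Y)"
      unfolding Y_def
    proof (rule mult_left_mono)
      have "x powr (q - 1) \<le> 2 powr (q - 1)" using x q by (intro powr_mono2) auto
      then show "1 \<le> 2 powr (q - 1) * x powr (- (q - 1))"
        using x by (simp only: powr_minus_divide) (simp add: field_simps)
    qed (use K in simp)
    moreover have "0 \<le> Y" by (simp add: Y_def)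
    moreover have "C * Y = Y + ln K * (2 powr (q - 1) * Y) + C1 / (q - 1) * Y"
      unfolding C_def distrib_right by (simp only: mult_1 mult.assoc)
    ultimately have "ln K + C1 / (q - 1) * Y \<le> C * Y"
      by simp
    then have "exp (ln K) * exp (C1 / (q - 1) * Y) \<le> exp (C * Y)"
      by (simp only: exp_le_cancel_iff flip: exp_add)
    moreover have "cmod (f z) \<le> exp (ln K) * exp (C1 / (q - 1) * Y)"
      using 1 K by (simp add: Y_def x_def)
    ultimately show ?thesis by (simp add: Y_def x_def q_def)
  qed
  then show thesis using that[OF C] by blast
qed

subsection \<open>Growth indicators\<close>

lemma le_exp_log_plus: "0 \<le> x \<Longrightarrow> x \<le> exp (log_plus x)"
  by (cases "x = 0") (auto simp: log_plus_def max_def not_le intro: order_trans[OF _ one_le_exp_iff[THEN iffD2]])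

lemma log_plus_le: "0 \<le> x \<Longrightarrow> x \<le> exp y \<Longrightarrow> 0 \<le> y \<Longrightarrow> log_plus x \<le> y"
  by (auto simp: log_plus_def) (metis ln_exp ln_le_cancel_iff exp_gt_zero order_le_less)

lemma log_plus_nonneg: "0 \<le> log_plus x"
  by (simp add: log_plus_def)

lemma log_plus_mono: "0 \<le> x \<Longrightarrow> x \<le> y \<Longrightarrow> log_plus x \<le> log_plus y"
  using le_exp_log_plus[of y] by (intro log_plus_le log_plus_nonneg) auto

lemma max_modulus_le:
  assumes "0 \<le> r" "\<And>z. cmod z = r \<Longrightarrow> cmod (g z) \<le> B"
  shows "max_modulus r g \<le> B"
  unfolding max_modulus_def using assms
  by (intro cSUP_least) (auto simp: dist_norm intro!: exI[of _ "of_real r"])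

lemma cmod_le_max_modulus:
  assumes hol: "g holomorphic_on ball 0 1" and z: "cmod z \<le> r" and r: "r < 1"
  shows "cmod (g z) \<le> max_modulus r g"
proof -
  have sub: "cball 0 r \<subseteq> ball 0 (1::real) " "cball (0::complex) r \<subseteq> ball 0 1" using r by auto
  have "continuous_on (sphere 0 r) (\<lambda>z. cmod (g z))"
    using sub by (intro continuous_on_norm holomorphic_on_imp_continuous_on holomorphic_on_subset[OF hol]) auto
  then have bdd: "bdd_above ((\<lambda>z. cmod (g z)) ` sphere 0 r)"
    by (intro bounded_imp_bdd_above compact_imp_bounded compact_continuous_image compact_sphere)
  show ?thesis
  proof (rule maximum_modulus_frontier[of g "cball 0 r"])
    show "g holomorphic_on interior (cball 0 r)"
      using sub by (intro holomorphic_on_subset[OF hol]) auto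
    show "continuous_on (closure (cball 0 r)) g"
      using sub by (simp add: holomorphic_on_imp_continuous_on holomorphic_on_subset[OF hol])
    show "cmod (g w) \<le> max_modulus r g" if "w \<in> frontier (cball 0 r)" for w
      unfolding max_modulus_def using that bdd by (intro cSUP_upper) (auto simp: frontier_cball)
  qed (use z in auto)
qed

lemma max_modulus_nonneg:
  assumes "g holomorphic_on ball 0 1" "0 \<le> r" "r < 1"
  shows "0 \<le> max_modulus r g"
  using cmod_le_max_modulus[OF assms(1), of 0 r] assms by (simp add: order_trans[OF norm_ge_zero])

lemma max_modulus_mono:
  assumes "g holomorphic_on ball 0 1" "0 \<le> r" "r \<le> r'" "r' < 1"
  shows "max_modulus r g \<le> max_modulus r' g"
  using assms by (intro max_modulus_le cmod_le_max_modulus) auto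

lemma eventually_at_left_1: "\<forall>\<^sub>F r in at_left (1::real). 0 < r \<and> r < 1"
  using eventually_at_left_real[of 0 "1::real"] by (auto elim: eventually_mono)

lemma le_powr_if_ratio_less:
  assumes "0 < r" "r < 1" "log_plus x / ln (1 / (1 - r)) < s"
  shows "x \<le> (1 - r) powr (- s)"
proof (cases "0 < x")
  case True
  have L: "0 < ln (1 / (1 - r))" using assms by simp
  have "ln x \<le> log_plus x" using True by (simp add: log_plus_def max.cobounded1)
  also have "\<dots> < s * ln (1 / (1 - r))" using assms L by (simp add: field_simps)
  also have "\<dots> = ln ((1 - r) powr (- s))" using assms by (simp add: ln_div ln_powr)
  finally have "ln x < ln ((1 - r) powr (- s))" .
  moreover have "0 < (1 - r) powr (- s)" using assms by simp
  ultimately show ?thesis using True by (meson less_imp_le ln_less_cancel_iff)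
next
  case False
  then show ?thesis by (meson not_less order_trans powr_ge_zero)
qed

lemma ratio_le_if_le_powr:
  assumes "0 < r" "r < 1" "0 \<le> x" "x \<le> C * (1 - r) powr (- s)" "1 \<le> C" "0 \<le> s"
  shows "log_plus x / ln (1 / (1 - r)) \<le> s + ln C / ln (1 / (1 - r))"
proof -
  have L: "0 < ln (1 / (1 - r))" using assms by simp
  have "exp (ln C + s * ln (1 / (1 - r))) = C * (1 - r) powr (- s)"
  proof -
    have "ln (1 / (1 - r)) = - ln (1 - r)" using assms by (simp add: ln_div)
    then show ?thesis using assms by (simp add: powr_def exp_add exp_minus exp_diff divide_inverse)
  qed
  then have "log_plus x \<le> ln C + s * ln (1 / (1 - r))"
    using assms L by (intro log_plus_le) auto
  then show ?thesis using L by (simp add: field_simps)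
qed

lemma tendsto_const_div_log: "((\<lambda>r. c / ln (1 / (1 - r))) \<longlongrightarrow> 0) (at_left (1::real))"
  by real_asymp

lemma eventually_le_powr:
  assumes "Limsup (at_left 1) (\<lambda>r. ereal (log_plus (\<phi> r) / ln (1 / (1 - r)))) < ereal s"
  shows "\<forall>\<^sub>F r in at_left 1. \<phi> r \<le> (1 - r) powr (- s)"
  using Limsup_lessD[OF assms] eventually_at_left_1
  by eventually_elim (simp add: le_powr_if_ratio_less)

lemma frequently_le_powr:
  assumes "Liminf (at_left 1) (\<lambda>r. ereal (log_plus (\<phi> r) / ln (1 / (1 - r)))) < ereal s"
  shows "\<exists>\<^sub>F r in at_left 1. \<phi> r \<le> (1 - r) powr (- s)"
  unfolding frequently_def
proof
  assume "\<forall>\<^sub>F r in at_left 1. \<not> \<phi> r \<le> (1 - r) powr (- s)"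
  with eventually_at_left_1
  have "\<forall>\<^sub>F r in at_left 1. ereal s \<le> ereal (log_plus (\<phi> r) / ln (1 / (1 - r)))"
  proof eventually_elim
    case (elim r)
    then have "\<not> log_plus (\<phi> r) / ln (1 / (1 - r)) < s"
      using le_powr_if_ratio_less by blast
    then show ?case by simp
  qed
  from Liminf_bounded[OF this] assms show False by simp
qed

text \<open>Near \<open>1\<close> the upper limit gives the bound with constant \<open>1\<close>; on
  the remaining radii monotonicity bounds \<open>\<phi>\<close> by one value, and the power is at
  least \<open>1\<close>.\<close>

lemma le_powr_everywhere:
  assumes "Limsup (at_left 1) (\<lambda>r. ereal (log_plus (\<phi> r) / ln (1 / (1 - r)))) < ereal s"
    and s: "0 \<le> s" and mono: "\<And>r r'. 0 \<le> r \<Longrightarrow> r \<le> r' \<Longrightarrow> r' < 1 \<Longrightarrow> \<phi> r \<le> \<phi> r'"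
  obtains C where "1 \<le> C" "\<And>r. 0 \<le> r \<Longrightarrow> r < 1 \<Longrightarrow> \<phi> r \<le> C * (1 - r) powr (- s)"
proof -
  have "\<forall>\<^sub>F r in at_left 1. 0 < r \<and> r < 1 \<and> \<phi> r \<le> (1 - r) powr (- s)"
    using eventually_le_powr[OF assms(1)] eventually_at_left_1 by eventually_elim auto
  then obtain b where b: "b < 1" "\<And>r. b < r \<Longrightarrow> r < 1 \<Longrightarrow> 0 < r \<and> \<phi> r \<le> (1 - r) powr (- s)"
    unfolding eventually_at_left_field by auto
  define r1 where "r1 = (1 + max b 0) / 2"
  have r1: "b < r1" "r1 < 1" "0 \<le> r1" using b by (auto simp: r1_def max_def field_simps)
  define C where "C = max 1 (\<phi> r1)"
  have "\<phi> r \<le> C * (1 - r) powr (- s)" if r: "0 \<le> r" "r < 1" for r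
  proof (cases "r \<le> r1")
    case True
    have "1 \<le> (1 - r) powr (- s)"
      using powr_mono2'[of "- s" "1 - r" 1] r s by simp
    then have "C * 1 \<le> C * (1 - r) powr (- s)" by (intro mult_left_mono) (auto simp: C_def)
    then show ?thesis using mono[OF r(1) True r1(2)] by (simp add: C_def)
  next
    case False
    then have "\<phi> r \<le> (1 - r) powr (- s)" using b(2)[of r] r1 r by auto
    also have "\<dots> \<le> C * (1 - r) powr (- s)" by (simp add: C_def mult_le_cancel_right1)
    finally show ?thesis .
  qed
  then show thesis using that[of C] by (simp add: C_def)
qed

text \<open>The factor \<open>C\<close> adds only \<open>ln C / ln (1 / (1 - r))\<close> to the
  ratio, which tends to \<open>0\<close>.\<close>

lemma Limsup_le_if_le_powr:
  assumes ev: "\<forall>\<^sub>F r in at_left 1. 0 \<le> \<phi> r \<and> \<phi> r \<le> C * (1 - r) powr (- s)" and C: "1 \<le> C" and s: "0 \<le> s"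
  shows "Limsup (at_left 1) (\<lambda>r. ereal (log_plus (\<phi> r) / ln (1 / (1 - r)))) \<le> ereal s"
proof -
  have "Limsup (at_left 1) (\<lambda>r. ereal (log_plus (\<phi> r) / ln (1 / (1 - r))))
      \<le> Limsup (at_left 1) (\<lambda>r. ereal (s + ln C / ln (1 / (1 - r))))"
  proof (rule Limsup_mono)
    show "\<forall>\<^sub>F r in at_left 1. ereal (log_plus (\<phi> r) / ln (1 / (1 - r))) \<le> ereal (s + ln C / ln (1 / (1 - r)))"
      using ev eventually_at_left_1 by eventually_elim (use ratio_le_if_le_powr[OF _ _ _ _ C s] in auto)
  qed
  also have "\<dots> = ereal (s + 0)"
    by (intro lim_imp_Limsup tendsto_intros tendsto_const_div_log) auto
  finally show ?thesis by simp
qed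

lemma Liminf_le_if_le_powr:
  assumes fr: "\<exists>\<^sub>F r in at_left 1. 0 \<le> \<phi> r \<and> \<phi> r \<le> C * (1 - r) powr (- s)" and C: "1 \<le> C" and s: "0 \<le> s"
  shows "Liminf (at_left 1) (\<lambda>r. ereal (log_plus (\<phi> r) / ln (1 / (1 - r)))) \<le> ereal s"
proof (rule ccontr)
  assume "\<not> ?thesis"
  then have "ereal s < Liminf (at_left 1) (\<lambda>r. ereal (log_plus (\<phi> r) / ln (1 / (1 - r))))"
    by (simp only: not_le)
  from ereal_dense2[OF this] obtain y where y: "ereal s < ereal y"
    "ereal y < Liminf (at_left 1) (\<lambda>r. ereal (log_plus (\<phi> r) / ln (1 / (1 - r))))"
    by blast
  have "\<forall>\<^sub>F r in at_left 1. ln C / ln (1 / (1 - r)) < y - s"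
    using order_tendstoD(2)[OF tendsto_const_div_log[of "ln C"]] y by simp
  moreover note less_LiminfD[OF y(2)]
  ultimately have "\<forall>\<^sub>F r in at_left 1. \<not> (0 \<le> \<phi> r \<and> \<phi> r \<le> C * (1 - r) powr (- s))"
    using eventually_at_left_1
  proof eventually_elim
    case (elim r)
    then show ?case using ratio_le_if_le_powr[of r "\<phi> r" C s] C s by (auto)
  qed
  then show False using fr by (simp add: frequently_def)
qed

section \<open>From growth of solutions to growth of the coefficient\<close>

lemma max_modulus_at_square:
  assumes sol: "disc_solution k A f" and nontriv: "nontrivial_on_disc f"
    and anA: "A analytic_on ball 0 1" and \<beta>: "0 < \<beta>" "\<beta> < 1" and \<epsilon>: "0 < \<epsilon>"
    and \<kappa>: "0 \<le> \<kappa>" and C0: "1 \<le> C0"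
  obtains C where "1 \<le> C" "\<forall>\<^sub>F r in at_left 1.
      (\<forall>z. cmod z \<le> r \<longrightarrow> cmod (f z) \<le> exp (C0 * (1 - r) powr (- \<kappa>) * (1 - cmod z) powr (- \<beta>))) \<longrightarrow>
      max_modulus (r\<^sup>2) A \<le> C * (1 - r\<^sup>2) powr (- ((\<kappa> + 2) * (1 + \<epsilon>) * real k))"
proof -
  obtain C d0 where C: "0 < C" and d0: "0 < d0" "d0 < 1"
    and bound: "\<And>d Q z. \<lbrakk>0 < d; d < d0; 1 \<le> Q;
      \<And>z. cmod z \<le> 1 - d \<Longrightarrow> cmod (f z) \<le> exp (Q * (1 - cmod z) powr (- \<beta>)); cmod z = (1 - d)\<^sup>2\<rbrakk>
      \<Longrightarrow> cmod (A z) \<le> C * ((Q / d\<^sup>2) powr (1 + \<epsilon>)) ^ k"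
    using coefficient_bound_near_circle[OF sol nontriv anA \<beta> \<epsilon>] by metis
  define e where "e = (\<kappa> + 2) * (1 + \<epsilon>) * real k"
  have e: "0 \<le> e" using \<kappa> \<epsilon> by (simp add: e_def)
  define C' where "C' = max 1 (C * (C0 powr (1 + \<epsilon>)) ^ k * 2 powr e)"
  have main: "max_modulus (r\<^sup>2) A \<le> C' * (1 - r\<^sup>2) powr (- e)"
    if r: "1 - d0 < r" "r < 1"
      and fb: "\<And>z. cmod z \<le> r \<Longrightarrow> cmod (f z) \<le> exp (C0 * (1 - r) powr (- \<kappa>) * (1 - cmod z) powr (- \<beta>))" for r
  proof (rule max_modulus_le)
    fix z assume z: "cmod z = r\<^sup>2"
    define d where "d = 1 - r"
    have d: "0 < d" "d < d0" "d < 1" using r d0 by (auto simp: d_def)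
    \<comment> \<open>The part of the exponent growing with the outer radius becomes the constant
      \<open>Q\<close>, leaving only the admissible power \<open>\<beta> < 1\<close> of the distance
      to the circle.\<close>
    define Q where "Q = C0 * d powr (- \<kappa>)"
    have "1 \<le> d powr (- \<kappa>)" using powr_mono2'[of "- \<kappa>" d 1] d \<kappa> by simp
    then have Q: "1 \<le> Q" using C0 mult_mono[of 1 C0 1 "d powr (- \<kappa>)"] by (simp add: Q_def)
    have "cmod (A z) \<le> C * ((Q / d\<^sup>2) powr (1 + \<epsilon>)) ^ k"
      using d Q z fb by (intro bound) (auto simp: d_def Q_def)
    also have "(Q / d\<^sup>2) powr (1 + \<epsilon>) = C0 powr (1 + \<epsilon>) * d powr (- ((\<kappa> + 2) * (1 + \<epsilon>)))"
    proof -
      have "d\<^sup>2 = d powr 2" using d by simp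
      then have "Q / d\<^sup>2 = C0 * d powr (- (\<kappa> + 2))"
        by (simp add: Q_def powr_diff powr_minus_divide powr_add)
      moreover have "- (\<kappa> + 2) * (1 + \<epsilon>) = - ((\<kappa> + 2) * (1 + \<epsilon>))" by (rule minus_mult_left[symmetric])
      ultimately show ?thesis using C0 by (simp only: powr_mult powr_powr)
    qed
    also have "(C0 powr (1 + \<epsilon>) * d powr (- ((\<kappa> + 2) * (1 + \<epsilon>)))) ^ k = (C0 powr (1 + \<epsilon>)) ^ k * d powr (- e)"
      using d by (simp add: power_mult_distrib powr_realpow[symmetric] powr_powr e_def)
    also have "d powr (- e) \<le> ((1 - r\<^sup>2) / 2) powr (- e)"
    proof (rule powr_mono2')
      have "0 < (1 - r) * (1 + r)" using r d0 by (intro mult_pos_pos) auto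
      then show "0 < (1 - r\<^sup>2) / 2" by (simp add: power2_eq_square algebra_simps)
      have "0 \<le> (1 - r) * (1 - r)" by simp
      then show "(1 - r\<^sup>2) / 2 \<le> d" by (simp add: d_def power2_eq_square field_simps)
    qed (use e in simp)
    also have "((1 - r\<^sup>2) / 2) powr (- e) = 2 powr e * (1 - r\<^sup>2) powr (- e)"
    proof -
      have "r\<^sup>2 \<le> 1" using r d0 by (simp add: power_le_one)
      then show ?thesis by (simp add: powr_divide powr_minus_divide)
    qed
    finally have "cmod (A z) \<le> C * ((C0 powr (1 + \<epsilon>)) ^ k * (2 powr e * (1 - r\<^sup>2) powr (- e)))"
      using C by (simp add: mult_left_mono)
    also have "\<dots> = (C * (C0 powr (1 + \<epsilon>)) ^ k * 2 powr e) * (1 - r\<^sup>2) powr (- e)"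
      by (simp only: mult.assoc)
    also have "\<dots> \<le> C' * (1 - r\<^sup>2) powr (- e)"
      by (intro mult_right_mono) (auto simp: C'_def)
    finally show "cmod (A z) \<le> C' * (1 - r\<^sup>2) powr (- e)" .
  qed simp
  have "\<forall>\<^sub>F r in at_left 1. 1 - d0 < r \<and> r < 1"
    using eventually_at_left_real[of "1 - d0" 1] d0 by (auto elim: eventually_mono)
  then have "\<forall>\<^sub>F r in at_left 1.
      (\<forall>z. cmod z \<le> r \<longrightarrow> cmod (f z) \<le> exp (C0 * (1 - r) powr (- \<kappa>) * (1 - cmod z) powr (- \<beta>))) \<longrightarrow>
      max_modulus (r\<^sup>2) A \<le> C' * (1 - r\<^sup>2) powr (- e)"
    by eventually_elim (use main in blast)
  then show thesis using that[of C'] by (simp add: C'_def e_def)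
qed

lemma le_if_le_slack:
  fixes a b c :: real
  assumes "\<And>\<epsilon>. 0 < \<epsilon> \<Longrightarrow> a \<le> b * (1 + \<epsilon>) * c"
  shows "a \<le> b * c"
proof -
  have "((\<lambda>\<epsilon>. b * (1 + \<epsilon>) * c) \<longlongrightarrow> b * (1 + 0) * c) (at_right 0)" by (intro tendsto_intros)
  moreover have "\<forall>\<^sub>F \<epsilon> in at_right 0. a \<le> b * (1 + \<epsilon>) * c"
    using eventually_at_right_less by (rule eventually_mono) (use assms in auto)
  ultimately show ?thesis using tendsto_lowerbound trivial_limit_at_right_real by force
qed

lemma lower_degree_le:
  assumes sol: "disc_solution k A f" and nontriv: "nontrivial_on_disc f"
    and anA: "A analytic_on ball 0 1" and \<beta>: "0 < \<beta>" "\<beta> < 1"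
    and \<kappa>: "0 \<le> \<kappa>" and C0: "1 \<le> C0" and p1: "lower_degree_growth A = ereal p1"
    and fr: "\<exists>\<^sub>F r in at_left 1. \<forall>z. cmod z \<le> r \<longrightarrow>
      cmod (f z) \<le> exp (C0 * (1 - r) powr (- \<kappa>) * (1 - cmod z) powr (- \<beta>))"
  shows "p1 \<le> (\<kappa> + 2) * real k"
proof (rule le_if_le_slack)
  fix \<epsilon> :: real assume \<epsilon>: "0 < \<epsilon>"
  define e where "e = (\<kappa> + 2) * (1 + \<epsilon>) * real k"
  obtain C where C: "1 \<le> C" and ev: "\<forall>\<^sub>F r in at_left 1.
      (\<forall>z. cmod z \<le> r \<longrightarrow> cmod (f z) \<le> exp (C0 * (1 - r) powr (- \<kappa>) * (1 - cmod z) powr (- \<beta>))) \<longrightarrow>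
      max_modulus (r\<^sup>2) A \<le> C * (1 - r\<^sup>2) powr (- e)"
    by (rule max_modulus_at_square[OF sol nontriv anA \<beta> \<epsilon> \<kappa> C0, folded e_def])
  have holA: "A holomorphic_on ball 0 1" using anA by (rule analytic_imp_holomorphic)
  \<comment> \<open>If the bound for \<open>A\<close> failed at all radii near \<open>1\<close>, it
    would fail at all their squares; the logarithmic derivative estimate then contradicts the
    frequent bound for \<open>f\<close>.\<close>
  have sq: "filterlim (\<lambda>r::real. r\<^sup>2) (at_left 1) (at_left 1)" by real_asymp
  have "\<exists>\<^sub>F r in at_left 1. 0 \<le> max_modulus r A \<and> max_modulus r A \<le> C * (1 - r) powr (- e)"
    unfolding frequently_def
  proof
    assume "\<forall>\<^sub>F r in at_left 1. \<not> (0 \<le> max_modulus r A \<and> max_modulus r A \<le> C * (1 - r) powr (- e))"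
    with eventually_at_left_1
    have "\<forall>\<^sub>F r in at_left 1. \<not> max_modulus r A \<le> C * (1 - r) powr (- e)"
      by eventually_elim (simp add: max_modulus_nonneg[OF holA])
    then have "\<forall>\<^sub>F r in at_left 1. \<not> max_modulus (r\<^sup>2) A \<le> C * (1 - r\<^sup>2) powr (- e)"
      by (rule eventually_compose_filterlim[OF _ sq])
    with ev have "\<forall>\<^sub>F r in at_left 1. \<not> (\<forall>z. cmod z \<le> r \<longrightarrow>
        cmod (f z) \<le> exp (C0 * (1 - r) powr (- \<kappa>) * (1 - cmod z) powr (- \<beta>)))"
      by eventually_elim blast
    then show False using fr unfolding frequently_def by contradiction
  qed
  moreover have "0 \<le> e" using \<kappa> \<epsilon> by (simp add: e_def)
  ultimately have "lower_degree_growth A \<le> ereal e"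
    unfolding lower_degree_growth_def by (intro Liminf_le_if_le_powr[OF _ C])
  then have "p1 \<le> e" unfolding p1 by simp
  then show "p1 \<le> (\<kappa> + 2) * (1 + \<epsilon>) * real k" by (simp add: e_def)
qed

lemma degree_le:
  assumes sol: "disc_solution k A f" and nontriv: "nontrivial_on_disc f"
    and anA: "A analytic_on ball 0 1" and \<beta>: "0 < \<beta>" "\<beta> < 1"
    and \<kappa>: "0 \<le> \<kappa>" and C0: "1 \<le> C0" and p2: "degree_growth A = ereal p2"
    and ev: "\<forall>\<^sub>F r in at_left 1. \<forall>z. cmod z \<le> r \<longrightarrow>
      cmod (f z) \<le> exp (C0 * (1 - r) powr (- \<kappa>) * (1 - cmod z) powr (- \<beta>))"
  shows "p2 \<le> (\<kappa> + 2) * real k"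
proof (rule le_if_le_slack)
  fix \<epsilon> :: real assume \<epsilon>: "0 < \<epsilon>"
  define e where "e = (\<kappa> + 2) * (1 + \<epsilon>) * real k"
  obtain C where C: "1 \<le> C" and ev': "\<forall>\<^sub>F r in at_left 1.
      (\<forall>z. cmod z \<le> r \<longrightarrow> cmod (f z) \<le> exp (C0 * (1 - r) powr (- \<kappa>) * (1 - cmod z) powr (- \<beta>))) \<longrightarrow>
      max_modulus (r\<^sup>2) A \<le> C * (1 - r\<^sup>2) powr (- e)"
    by (rule max_modulus_at_square[OF sol nontriv anA \<beta> \<epsilon> \<kappa> C0, folded e_def])
  have holA: "A holomorphic_on ball 0 1" using anA by (rule analytic_imp_holomorphic)
  have sqrt: "filterlim sqrt (at_left 1) (at_left (1::real))" by real_asymp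
  have "\<forall>\<^sub>F r in at_left 1. max_modulus (r\<^sup>2) A \<le> C * (1 - r\<^sup>2) powr (- e)"
    using ev ev' by eventually_elim blast
  then have "\<forall>\<^sub>F r in at_left 1. max_modulus ((sqrt r)\<^sup>2) A \<le> C * (1 - (sqrt r)\<^sup>2) powr (- e)"
    by (rule eventually_compose_filterlim[OF _ sqrt])
  with eventually_at_left_1
  have "\<forall>\<^sub>F r in at_left 1. 0 \<le> max_modulus r A \<and> max_modulus r A \<le> C * (1 - r) powr (- e)"
    by eventually_elim (simp add: max_modulus_nonneg[OF holA])
  moreover have "0 \<le> e" using \<kappa> \<epsilon> by (simp add: e_def)
  ultimately have "degree_growth A \<le> ereal e"
    unfolding degree_growth_def by (intro Limsup_le_if_le_powr[OF _ C])
  then have "p2 \<le> e" unfolding p2 by simp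
  then show "p2 \<le> (\<kappa> + 2) * (1 + \<epsilon>) * real k" by (simp add: e_def)
qed

text \<open>For a function vanishing on the disc, the convention \<open>log_plus 0 = 0\<close> makes
  every ratio zero.\<close>

lemma order_growth_pos_imp_nontrivial:
  assumes "order_growth f > 0"
  shows "nontrivial_on_disc f"
proof (rule ccontr)
  assume "\<not> ?thesis"
  then have f0: "f z = 0" if "cmod z < 1" for z using that by (auto simp: nontrivial_on_disc_def)
  have z: "log_plus (log_plus (max_modulus r f)) = 0" if r: "0 < r" "r < 1" for r
  proof -
    have "(\<lambda>z. cmod (f z)) ` sphere 0 r = {0}"
      using r f0 by (force intro: image_eqI[of _ _ "of_real r"])
    then have "max_modulus r f = 0" by (simp add: max_modulus_def)
    then show ?thesis by (simp add: log_plus_def)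
  qed
  have "\<forall>\<^sub>F r in at_left 1. ereal (log_plus (log_plus (max_modulus r f)) / ln (1 / (1 - r))) \<le> 0"
    using eventually_at_left_1 by eventually_elim (simp add: z)
  then have "order_growth f \<le> 0" unfolding order_growth_def by (rule Limsup_bounded)
  then show False using assms by simp
qed

lemma lower_order_growth_nonneg: "0 \<le> lower_order_growth f"
proof -
  have "\<forall>\<^sub>F r in at_left 1. 0 \<le> ereal (log_plus (log_plus (max_modulus r f)) / ln (1 / (1 - r)))"
    using eventually_at_left_1 by eventually_elim (simp add: log_plus_nonneg)
  then show ?thesis unfolding lower_order_growth_def by (rule Liminf_bounded)
qed

lemma lower_order_growth_le_order_growth: "lower_order_growth f \<le> order_growth f"
  unfolding lower_order_growth_def order_growth_def by (rule Liminf_le_Limsup) simp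

lemma log_plus_max_modulus_mono:
  assumes "f holomorphic_on ball 0 1" "0 \<le> r" "r \<le> r'" "r' < 1"
  shows "log_plus (max_modulus r f) \<le> log_plus (max_modulus r' f)"
  using assms max_modulus_nonneg max_modulus_mono by (intro log_plus_mono) auto

lemma cmod_le_exp_log_plus_max_modulus:
  assumes "f holomorphic_on ball 0 1" "cmod z \<le> r" "r < 1"
  shows "cmod (f z) \<le> exp (log_plus (max_modulus r f))"
proof -
  have "0 \<le> r" using assms(2) norm_ge_zero[of z] by linarith
  then show ?thesis
    using cmod_le_max_modulus[OF assms] le_exp_log_plus[OF max_modulus_nonneg[OF assms(1)], of r] assms(3)
    by linarith
qed

lemma order_growth_bound:
  assumes hol: "f holomorphic_on ball 0 1" and s: "order_growth f < ereal s" "0 \<le> s"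
  obtains C where "1 \<le> C" "\<And>z. cmod z < 1 \<Longrightarrow> cmod (f z) \<le> exp (C * (1 - cmod z) powr (- s))"
proof -
  obtain C where C: "1 \<le> C" "\<And>r. 0 \<le> r \<Longrightarrow> r < 1 \<Longrightarrow> log_plus (max_modulus r f) \<le> C * (1 - r) powr (- s)"
    using le_powr_everywhere[OF s(1)[unfolded order_growth_def] s(2)] log_plus_max_modulus_mono[OF hol] by metis
  have "cmod (f z) \<le> exp (C * (1 - cmod z) powr (- s))" if "cmod z < 1" for z
    using cmod_le_exp_log_plus_max_modulus[OF hol _ that, of z] C(2)[OF _ that]
    by (meson exp_le_cancel_iff norm_ge_zero order_refl order_trans)
  then show thesis using that C by blast
qed

lemma degree_growth_bound:
  assumes hol: "A holomorphic_on ball 0 1" and s: "degree_growth A < ereal s" "0 \<le> s"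
  obtains C where "1 \<le> C" "\<And>z. cmod z < 1 \<Longrightarrow> cmod (A z) \<le> C * (1 - cmod z) powr (- s)"
proof -
  obtain C where C: "1 \<le> C" "\<And>r. 0 \<le> r \<Longrightarrow> r < 1 \<Longrightarrow> max_modulus r A \<le> C * (1 - r) powr (- s)"
    using le_powr_everywhere[OF s(1)[unfolded degree_growth_def] s(2)] max_modulus_mono[OF hol] by metis
  have "cmod (A z) \<le> C * (1 - cmod z) powr (- s)" if "cmod z < 1" for z
    using cmod_le_max_modulus[OF hol _ that, of z] C(2)[OF _ that]
    by (meson norm_ge_zero order_refl order_trans)
  then show thesis using that C by blast
qed

lemma min_le_powr_interpolate:
  fixes a b \<theta> :: real
  assumes "0 < a" "0 < b" "0 \<le> \<theta>" "\<theta> \<le> 1"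
  shows "min a b \<le> a powr \<theta> * b powr (1 - \<theta>)"
proof -
  have "min a b = min a b powr \<theta> * min a b powr (1 - \<theta>)"
    using assms by (simp flip: powr_add)
  also have "\<dots> \<le> a powr \<theta> * b powr (1 - \<theta>)"
    using assms by (intro mult_mono powr_mono2) auto
  finally show ?thesis .
qed

text \<open>This serves solutions of infinite order, where there is nothing to interpolate with. The
  maximum modulus bound is inflated by \<open>(1 - cmod z) powr (- (1 / 2)) \<ge> 1\<close> merely
  to fit the required form.\<close>

lemma lower_degree_le_lower_order:
  assumes sol: "disc_solution k A f" and nontriv: "nontrivial_on_disc f"
    and anA: "A analytic_on ball 0 1" and p1: "lower_degree_growth A = ereal p1"
    and l: "lower_order_growth f = ereal l"
  shows "p1 \<le> (l + 2) * real k"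
proof -
  have holf: "f holomorphic_on ball 0 1"
    using sol by (simp add: disc_solution_def analytic_imp_holomorphic)
  have l0: "0 \<le> l" using lower_order_growth_nonneg[of f] l by simp
  have bound: "p1 \<le> (\<kappa> + 2) * real k" if \<kappa>: "l < \<kappa>" for \<kappa>
  proof (rule lower_degree_le[OF sol nontriv anA _ _ _ order_refl p1, of "1 / 2"])
    show "0 \<le> \<kappa>" using l0 \<kappa> by simp
    have "\<exists>\<^sub>F r in at_left 1. log_plus (max_modulus r f) \<le> (1 - r) powr (- \<kappa>)"
      using frequently_le_powr[of "\<lambda>r. log_plus (max_modulus r f)" \<kappa>] l \<kappa> by (simp add: lower_order_growth_def)
    from this eventually_at_left_1
    have "\<exists>\<^sub>F r in at_left 1. log_plus (max_modulus r f) \<le> (1 - r) powr (- \<kappa>) \<and> (0 < r \<and> r < 1)"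
      by (rule frequently_eventually_frequently)
    then show "\<exists>\<^sub>F r in at_left 1. \<forall>z. cmod z \<le> r \<longrightarrow>
        cmod (f z) \<le> exp (1 * (1 - r) powr (- \<kappa>) * (1 - cmod z) powr (- (1 / 2)))"
    proof (rule frequently_mono[rotated], intro allI impI)
      fix r z assume r: "log_plus (max_modulus r f) \<le> (1 - r) powr (- \<kappa>) \<and> (0 < r \<and> r < 1)" and z: "cmod z \<le> r"
      have "1 \<le> (1 - cmod z) powr (- (1 / 2))"
        using powr_mono2'[of "- (1 / 2)" "1 - cmod z" 1] r z by simp
      then have "(1 - r) powr (- \<kappa>) * 1 \<le> (1 - r) powr (- \<kappa>) * (1 - cmod z) powr (- (1 / 2))"
        by (intro mult_left_mono) auto
      moreover have "log_plus (max_modulus r f) \<le> (1 - r) powr (- \<kappa>)" using r by blast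
      ultimately have "log_plus (max_modulus r f) \<le> 1 * (1 - r) powr (- \<kappa>) * (1 - cmod z) powr (- (1 / 2))"
        unfolding mult_1 mult_1_right by (rule order_trans[rotated])
      then show "cmod (f z) \<le> exp (1 * (1 - r) powr (- \<kappa>) * (1 - cmod z) powr (- (1 / 2)))"
        using cmod_le_exp_log_plus_max_modulus[OF holf z] r by (meson exp_le_cancel_iff order_trans)
    qed
  qed auto
  have "((\<lambda>\<kappa>. (\<kappa> + 2) * real k) \<longlongrightarrow> (l + 2) * real k) (at_right l)" by (intro tendsto_intros)
  moreover have "\<forall>\<^sub>F \<kappa> in at_right l. p1 \<le> (\<kappa> + 2) * real k"
    using eventually_at_right_less[of l] by (rule eventually_mono) (use bound in auto)
  ultimately show ?thesis using tendsto_lowerbound trivial_limit_at_right_real by blast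
qed

text \<open>At radii attaining the lower order, \<open>ln |f|\<close> obeys both the global bound
  from the order and a constant bound from the maximum modulus. A weighted geometric mean of the two
  has \<open>\<beta>\<close> just below \<open>1\<close>. Replacing \<open>S\<close> by
  \<open>max S 1\<close> keeps the weight at most \<open>1\<close>.\<close>

lemma lower_degree_le_of_finite_order:
  assumes sol: "disc_solution k A f" and nontriv: "nontrivial_on_disc f"
    and anA: "A analytic_on ball 0 1" and p1: "lower_degree_growth A = ereal p1"
    and l: "lower_order_growth f = ereal l" and S: "order_growth f = ereal S"
  shows "p1 \<le> (l * (1 - 1 / max S 1) + 2) * real k"
proof -
  have holf: "f holomorphic_on ball 0 1"
    using sol by (simp add: disc_solution_def analytic_imp_holomorphic)
  have l0: "0 \<le> l" using lower_order_growth_nonneg[of f] l by simp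
  define m where "m = max S 1"
  have m: "S \<le> m" "1 \<le> m" by (auto simp: m_def)
  have bound: "p1 \<le> ((l + e) * (1 - (1 - e) / (m + e)) + 2) * real k" if e: "0 < e" "e < 1" for e
  proof -
    define s where "s = m + e"
    \<comment> \<open>The weight makes \<open>s * \<theta> = 1 - e\<close>, the largest share of the
      order bound that leaves an exponent below \<open>1\<close>; the other factor then has exponent
      \<open>(l + e) * (1 - \<theta>)\<close>.\<close>
    define \<theta> where "\<theta> = (1 - e) / s"
    have \<theta>: "0 \<le> \<theta>" "\<theta> \<le> 1" "s * \<theta> = 1 - e" using e m by (auto simp: \<theta>_def s_def field_simps)
    obtain C where C: "1 \<le> C" "\<And>z. cmod z < 1 \<Longrightarrow> cmod (f z) \<le> exp (C * (1 - cmod z) powr (- s))"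
      using order_growth_bound[OF holf, of s] S m e by (auto simp: s_def)
    have "p1 \<le> ((l + e) * (1 - \<theta>) + 2) * real k"
    proof (rule lower_degree_le[OF sol nontriv anA _ _ _ C(1) p1, of "1 - e"])
      show "0 \<le> (l + e) * (1 - \<theta>)" using l0 e \<theta> by simp
      have "\<exists>\<^sub>F r in at_left 1. log_plus (max_modulus r f) \<le> (1 - r) powr (- (l + e))"
        using frequently_le_powr[of "\<lambda>r. log_plus (max_modulus r f)" "l + e"] l e by (simp add: lower_order_growth_def)
      from this eventually_at_left_1
      have "\<exists>\<^sub>F r in at_left 1. log_plus (max_modulus r f) \<le> (1 - r) powr (- (l + e)) \<and> (0 < r \<and> r < 1)"
        by (rule frequently_eventually_frequently)
      then show "\<exists>\<^sub>F r in at_left 1. \<forall>z. cmod z \<le> r \<longrightarrow>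
          cmod (f z) \<le> exp (C * (1 - r) powr (- ((l + e) * (1 - \<theta>))) * (1 - cmod z) powr (- (1 - e)))"
      proof (rule frequently_mono[rotated], intro allI impI)
        fix r z assume r: "log_plus (max_modulus r f) \<le> (1 - r) powr (- (l + e)) \<and> (0 < r \<and> r < 1)" and z: "cmod z \<le> r"
        define a where "a = (1 - cmod z) powr (- s)"
        define b where "b = (1 - r) powr (- (l + e))"
        have ab: "0 < a" "0 < b" using r z by (auto simp: a_def b_def)
        have "cmod (f z) \<le> exp (C * a)" using C(2)[of z] r z by (simp add: a_def)
        moreover have "cmod (f z) \<le> exp (C * b)"
        proof -
          have "1 * b \<le> C * b" using C ab by (intro mult_right_mono) auto
          moreover have "log_plus (max_modulus r f) \<le> b" using r unfolding b_def by blast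
          ultimately have "log_plus (max_modulus r f) \<le> C * b" by linarith
          then show ?thesis
            using cmod_le_exp_log_plus_max_modulus[OF holf z] r by (meson exp_le_cancel_iff order_trans)
        qed
        ultimately have "cmod (f z) \<le> exp (C * min a b)" by (simp add: min_def)
        also have "C * min a b \<le> C * (a powr \<theta> * b powr (1 - \<theta>))"
          using min_le_powr_interpolate[OF ab \<theta>(1,2)] C by (intro mult_left_mono) auto
        also have "a powr \<theta> = (1 - cmod z) powr (- (1 - e))"
          using \<theta>(3) by (simp add: a_def powr_powr)
        also have "b powr (1 - \<theta>) = (1 - r) powr (- ((l + e) * (1 - \<theta>)))"
          by (simp only: b_def powr_powr minus_mult_left)
        finally show "cmod (f z) \<le> exp (C * (1 - r) powr (- ((l + e) * (1 - \<theta>))) * (1 - cmod z) powr (- (1 - e)))"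
          by (simp add: mult_ac)
      qed
    qed (use e in auto)
    then show ?thesis by (simp add: \<theta>_def s_def)
  qed
  have "((\<lambda>e. ((l + e) * (1 - (1 - e) / (m + e)) + 2) * real k) \<longlongrightarrow>
      ((l + 0) * (1 - (1 - 0) / (m + 0)) + 2) * real k) (at_right 0)"
    using m by (intro tendsto_intros) auto
  moreover have "\<forall>\<^sub>F e in at_right 0. p1 \<le> ((l + e) * (1 - (1 - e) / (m + e)) + 2) * real k"
    using eventually_at_right_real[of 0 "1::real"] by (rule eventually_mono) (use bound in auto)
  ultimately have "p1 \<le> ((l + 0) * (1 - (1 - 0) / (m + 0)) + 2) * real k"
    using tendsto_lowerbound trivial_limit_at_right_real by blast
  then show ?thesis by (simp add: m_def)
qed

lemma degree_le_of_finite_order: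
  assumes sol: "disc_solution k A f" and nontriv: "nontrivial_on_disc f"
    and anA: "A analytic_on ball 0 1" and p2: "degree_growth A = ereal p2" and S: "order_growth f = ereal S"
  shows "p2 \<le> (max S 1 + 1) * real k"
proof -
  have holf: "f holomorphic_on ball 0 1"
    using sol by (simp add: disc_solution_def analytic_imp_holomorphic)
  define m where "m = max S 1"
  have m: "S \<le> m" "1 \<le> m" by (auto simp: m_def)
  have bound: "p2 \<le> (m + 2 * e + 1) * real k" if e: "0 < e" "e < 1" for e
  proof -
    obtain C where C: "1 \<le> C" "\<And>z. cmod z < 1 \<Longrightarrow> cmod (f z) \<le> exp (C * (1 - cmod z) powr (- (m + e)))"
      using order_growth_bound[OF holf, of "m + e"] S m e by auto
    have "p2 \<le> ((m + 2 * e - 1) + 2) * real k"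
    proof (rule degree_le[OF sol nontriv anA _ _ _ C(1) p2, of "1 - e"])
      show "\<forall>\<^sub>F r in at_left 1. \<forall>z. cmod z \<le> r \<longrightarrow>
          cmod (f z) \<le> exp (C * (1 - r) powr (- (m + 2 * e - 1)) * (1 - cmod z) powr (- (1 - e)))"
        using eventually_at_left_1
      proof (rule eventually_mono, intro allI impI)
        fix r z assume r: "0 < r \<and> r < (1::real)" and z: "cmod z \<le> r"
        \<comment> \<open>Only the exponent \<open>1 - e\<close> may remain attached to
          \<open>z\<close>. The excess \<open>m + 2 * e - 1\<close> is nonnegative because
          \<open>m \<ge> 1\<close>, so it may be evaluated at the outer radius.\<close>
        have "(1 - cmod z) powr (- (m + e)) = (1 - cmod z) powr (- (m + 2 * e - 1)) * (1 - cmod z) powr (- (1 - e))"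
        proof -
          have "- (m + e) = - (m + 2 * e - 1) + - (1 - e)" by simp
          then show ?thesis by (simp only: powr_add)
        qed
        also have "\<dots> \<le> (1 - r) powr (- (m + 2 * e - 1)) * (1 - cmod z) powr (- (1 - e))"
          using r z m e by (intro mult_right_mono powr_mono2') auto
        finally have "C * (1 - cmod z) powr (- (m + e)) \<le> C * ((1 - r) powr (- (m + 2 * e - 1)) * (1 - cmod z) powr (- (1 - e)))"
          using C by (intro mult_left_mono) auto
        then show "cmod (f z) \<le> exp (C * (1 - r) powr (- (m + 2 * e - 1)) * (1 - cmod z) powr (- (1 - e)))"
          using C(2)[of z] r z by (simp only: mult.assoc) (meson exp_le_cancel_iff le_less_trans order_trans)
      qed
    qed (use e m in auto)
    moreover have "(m + 2 * e - 1) + 2 = m + 2 * e + 1" by simp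
    ultimately show ?thesis by (simp only:)
  qed
  have "((\<lambda>e. (m + 2 * e + 1) * real k) \<longlongrightarrow> (m + 2 * 0 + 1) * real k) (at_right 0)"
    by (intro tendsto_intros)
  moreover have "\<forall>\<^sub>F e in at_right 0. p2 \<le> (m + 2 * e + 1) * real k"
    using eventually_at_right_real[of 0 "1::real"] by (rule eventually_mono) (use bound in auto)
  ultimately have "p2 \<le> (m + 2 * 0 + 1) * real k"
    using tendsto_lowerbound trivial_limit_at_right_real by blast
  then show ?thesis by (simp add: m_def)
qed

section \<open>From growth of the coefficient to growth of solutions\<close>

lemma order_growth_le:
  assumes sol: "disc_solution k A f" and k: "1 \<le> k" and anA: "A analytic_on ball 0 1"
    and p2: "degree_growth A = ereal p2" "real k \<le> p2"
  shows "order_growth f \<le> ereal (p2 / real k - 1)"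
proof (rule ereal_le_epsilon2)
  fix e :: real assume e: "0 < e"
  have holf: "f holomorphic_on ball 0 1"
    using sol by (simp add: disc_solution_def analytic_imp_holomorphic)
  \<comment> \<open>Multiplying \<open>e\<close> by \<open>k\<close> makes \<open>s / k - 1\<close>
    exceed the target by exactly \<open>e\<close>; it also gives \<open>s > k\<close>, as the
    majorant requires.\<close>
  define s where "s = p2 + real k * e"
  have s: "p2 < s" "real k < s" using e k p2 by (auto simp: s_def intro: le_less_trans)
  obtain C0 where C0: "1 \<le> C0" "\<And>z. cmod z < 1 \<Longrightarrow> cmod (A z) \<le> C0 * (1 - cmod z) powr (- s)"
    using degree_growth_bound[OF analytic_imp_holomorphic[OF anA], of s] p2 s by auto
  obtain C where C: "1 \<le> C" and fb: "\<And>\<delta> r z. \<lbrakk>0 \<le> \<delta>; \<delta> \<le> 1; r < 1;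
      \<And>z. cmod z \<le> r \<Longrightarrow> cmod (A z) \<le> C0 * (1 + \<delta> - cmod z) powr (- s); cmod z \<le> r\<rbrakk>
      \<Longrightarrow> cmod (f z) \<le> exp (C * (1 + \<delta> - cmod z) powr (- (s / real k - 1)))"
    using solution_growth[OF sol k s(2) C0(1)] by metis
  have "order_growth f \<le> ereal (s / real k - 1)"
    unfolding order_growth_def
  proof (rule Limsup_le_if_le_powr[OF _ C])
    show "\<forall>\<^sub>F r in at_left 1. 0 \<le> log_plus (max_modulus r f) \<and>
        log_plus (max_modulus r f) \<le> C * (1 - r) powr (- (s / real k - 1))"
      using eventually_at_left_1
    proof (rule eventually_mono, intro conjI log_plus_nonneg)
      fix r :: real assume r: "0 < r \<and> r < 1"
      have "max_modulus r f \<le> exp (C * (1 - r) powr (- (s / real k - 1)))"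
      proof (rule max_modulus_le)
        fix z assume "cmod z = r"
        then show "cmod (f z) \<le> exp (C * (1 - r) powr (- (s / real k - 1)))"
          using fb[of 0 r z] C0(2) r by simp
      qed (use r in simp)
      then show "log_plus (max_modulus r f) \<le> C * (1 - r) powr (- (s / real k - 1))"
        using C r max_modulus_nonneg[OF holf] by (intro log_plus_le) auto
    qed
    show "0 \<le> s / real k - 1" using s k by (simp add: field_simps)
  qed
  also have "s / real k - 1 = p2 / real k - 1 + e" using k by (simp add: s_def field_simps)
  finally show "order_growth f \<le> ereal (p2 / real k - 1) + ereal e" by simp
qed

text \<open>At radii where the maximum modulus of \<open>A\<close> is small, \<open>A\<close> obeys
  that uniform bound in addition to the global one. A weight shifted by \<open>\<delta>\<close>
  majorizes the smaller of the two, and the solution then grows at most like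
  \<open>exp (C * \<delta> powr (- q))\<close>.\<close>

lemma lower_order_growth_le:
  assumes sol: "disc_solution k A f" and k: "1 \<le> k" and anA: "A analytic_on ball 0 1"
    and p2: "degree_growth A = ereal p2" "real k \<le> p2"
    and p1: "lower_degree_growth A = ereal p1" "0 < p1" and l: "lower_order_growth f = ereal l"
  shows "l \<le> p1 * (p2 / real k - 1) / p2"
proof -
  have holf: "f holomorphic_on ball 0 1"
    using sol by (simp add: disc_solution_def analytic_imp_holomorphic)
  have holA: "A holomorphic_on ball 0 1" using anA by (rule analytic_imp_holomorphic)
  have bound: "l \<le> (p1 + e) * ((p2 + e) / real k - 1) / (p2 + e)" if e: "0 < e" for e
  proof -
    define s where "s = p2 + e"
    define t where "t = p1 + e"
    have s: "p2 < s" "real k < s" "0 < s" using e k p2 by (auto simp: s_def)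
    have t: "p1 < t" "0 < t" using e p1 by (auto simp: t_def)
    obtain C0 where C0: "1 \<le> C0" "\<And>z. cmod z < 1 \<Longrightarrow> cmod (A z) \<le> C0 * (1 - cmod z) powr (- s)"
      using degree_growth_bound[OF holA, of s] p2 s by auto
    define C1 where "C1 = C0 * 2 powr s"
    have C1: "1 \<le> C1" "0 < C1"
      using C0 s mult_mono[of 1 C0 1 "2 powr s"] ge_one_powr_ge_zero[of 2 s] by (auto simp: C1_def)
    obtain C where C: "1 \<le> C" and fb: "\<And>\<delta> r z. \<lbrakk>0 \<le> \<delta>; \<delta> \<le> 1; r < 1;
        \<And>z. cmod z \<le> r \<Longrightarrow> cmod (A z) \<le> C1 * (1 + \<delta> - cmod z) powr (- s); cmod z \<le> r\<rbrakk>
        \<Longrightarrow> cmod (f z) \<le> exp (C * (1 + \<delta> - cmod z) powr (- (s / real k - 1)))"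
      using solution_growth[OF sol k s(2) C1(1)] by metis
    define q where "q = s / real k - 1"
    have q: "0 < q" using s k by (simp add: q_def field_simps)
    have "\<exists>\<^sub>F r in at_left 1. max_modulus r A \<le> (1 - r) powr (- t)"
      using frequently_le_powr[of "\<lambda>r. max_modulus r A" t] p1 t by (simp add: lower_degree_growth_def)
    from this eventually_at_left_1
    have "\<exists>\<^sub>F r in at_left 1. max_modulus r A \<le> (1 - r) powr (- t) \<and> (0 < r \<and> r < 1)"
      by (rule frequently_eventually_frequently)
    then have "\<exists>\<^sub>F r in at_left 1. 0 \<le> log_plus (max_modulus r f) \<and>
        log_plus (max_modulus r f) \<le> C * (1 - r) powr (- (t * q / s))"
    proof (rule frequently_mono[rotated], intro allI impI conjI log_plus_nonneg)
      fix r assume r: "max_modulus r A \<le> (1 - r) powr (- t) \<and> (0 < r \<and> r < 1)"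
      \<comment> \<open>Chosen so that \<open>\<delta> powr (- s) = (1 - r) powr (- t)\<close>, the
        bound for \<open>A\<close> on the disc of radius \<open>r\<close>.\<close>
      define \<delta> where "\<delta> = (1 - r) powr (t / s)"
      have \<delta>: "0 < \<delta>" "\<delta> \<le> 1" using r s t by (auto simp: \<delta>_def intro!: powr_le1)
      have Ab: "cmod (A z) \<le> C1 * (1 + \<delta> - cmod z) powr (- s)" if z: "cmod z \<le> r" for z
      proof -
        have z1: "cmod z < 1" using z r by linarith
        have "cmod (A z) \<le> max_modulus r A" using cmod_le_max_modulus[OF holA z] r by simp
        also have "\<dots> \<le> \<delta> powr (- s)" using r s by (simp add: \<delta>_def powr_powr)
        also have "\<dots> \<le> C0 * \<delta> powr (- s)" using C0 by (simp add: mult_le_cancel_right1)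
        finally have "cmod (A z) \<le> C0 * max (1 - cmod z) \<delta> powr (- s)"
          using C0(2)[OF z1] by (simp add: max_def)
        also have "max (1 - cmod z) \<delta> powr (- s) \<le> ((1 + \<delta> - cmod z) / 2) powr (- s)"
          using z1 \<delta> s by (intro powr_mono2') (auto simp: max_def)
        also have "\<dots> = 2 powr s * (1 + \<delta> - cmod z) powr (- s)"
          using z1 \<delta> by (simp add: powr_divide powr_minus_divide)
        finally show ?thesis using C0 by (simp add: C1_def mult.assoc)
      qed
      have "max_modulus r f \<le> exp (C * (1 - r) powr (- (t * q / s)))"
      proof (rule max_modulus_le)
        fix z assume z: "cmod z = r"
        have "cmod (f z) \<le> exp (C * (1 + \<delta> - cmod z) powr (- q))"
          unfolding q_def using fb[of \<delta> r z] Ab \<delta> r z by auto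
        also have "(1 + \<delta> - cmod z) powr (- q) \<le> \<delta> powr (- q)"
          using \<delta> q z r by (intro powr_mono2') auto
        also have "\<delta> powr (- q) = (1 - r) powr (- (t * q / s))"
          by (simp add: \<delta>_def powr_powr)
        finally show "cmod (f z) \<le> exp (C * (1 - r) powr (- (t * q / s)))"
          using C by simp
      qed (use r in simp)
      then show "log_plus (max_modulus r f) \<le> C * (1 - r) powr (- (t * q / s))"
        using C r max_modulus_nonneg[OF holf] by (intro log_plus_le) auto
    qed
    moreover have "0 \<le> t * q / s" using t q s by simp
    ultimately have "lower_order_growth f \<le> ereal (t * q / s)"
      unfolding lower_order_growth_def by (intro Liminf_le_if_le_powr[OF _ C])
    then show ?thesis unfolding l by (simp add: t_def q_def s_def)
  qed
  have "((\<lambda>e. (p1 + e) * ((p2 + e) / real k - 1) / (p2 + e)) \<longlongrightarrow>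
      (p1 + 0) * ((p2 + 0) / real k - 1) / (p2 + 0)) (at_right 0)"
    using k p2 by (intro tendsto_intros) auto
  moreover have "\<forall>\<^sub>F e in at_right 0. l \<le> (p1 + e) * ((p2 + e) / real k - 1) / (p2 + e)"
    using eventually_at_right_less by (rule eventually_mono) (use bound in auto)
  ultimately have "l \<le> (p1 + 0) * ((p2 + 0) / real k - 1) / (p2 + 0)"
    using tendsto_lowerbound trivial_limit_at_right_real by blast
  then show ?thesis by simp
qed

section \<open>The two assertions\<close>

lemma lower_degree_bound:
  assumes k: "1 \<le> k" and anA: "A analytic_on ball 0 1" and p1: "lower_degree_growth A = ereal p1"
    and sol: "disc_solution k A f" and pos: "order_growth f > 0"
  shows "ereal (p1 / real k - 1)
    \<le> 1 + max (lower_order_growth f - lower_order_growth f / order_growth f) 0"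
proof -
  have nontriv: "nontrivial_on_disc f" by (rule order_growth_pos_imp_nontrivial[OF pos])
  show ?thesis
  proof (cases "lower_order_growth f")
    case (real l)
    show ?thesis
    proof (cases "order_growth f")
      case (real S)
      have S: "0 < S" using pos real by simp
      have l0: "0 \<le> l" using lower_order_growth_nonneg[of f] \<open>lower_order_growth f = ereal l\<close> by simp
      have "p1 \<le> (l * (1 - 1 / max S 1) + 2) * real k"
        by (rule lower_degree_le_of_finite_order[OF sol nontriv anA p1 \<open>lower_order_growth f = ereal l\<close> real])
      then have "p1 / real k - 1 \<le> 1 + l * (1 - 1 / max S 1)" using k by (simp add: field_simps)
      \<comment> \<open>For \<open>S \<ge> 1\<close> the left side is \<open>l - l / S\<close>; for
        \<open>S < 1\<close> it is \<open>0\<close>. The positive part covers both.\<close>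
      also have "l * (1 - 1 / max S 1) \<le> max (l - l / S) 0"
        by (cases "1 \<le> S") (auto simp: max_def algebra_simps)
      finally show ?thesis using S real \<open>lower_order_growth f = ereal l\<close>
        by (simp add: one_ereal_def zero_ereal_def flip: ereal_max)
    next
      \<comment> \<open>Here \<open>l / \<infinity> = 0\<close>, so the right-hand side is
        \<open>1 + l\<close>.\<close>
      case PInf
      have "p1 \<le> (l + 2) * real k"
        by (rule lower_degree_le_lower_order[OF sol nontriv anA p1 real])
      then have "p1 / real k - 1 \<le> 1 + l" using k by (simp add: field_simps)
      moreover have "0 \<le> l" using lower_order_growth_nonneg[of f] real by simp
      ultimately show ?thesis using real PInf by (simp add: one_ereal_def zero_ereal_def flip: ereal_max)
    next
      case MInf
      then show ?thesis using pos by simp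
    qed
  next
    \<comment> \<open>In \<open>ereal\<close> the quotient \<open>\<infinity> / \<infinity>\<close>
      is \<open>\<infinity> * 0 = 0\<close>, so the right-hand side is infinite.\<close>
    case PInf
    then have "order_growth f = \<infinity>" using lower_order_growth_le_order_growth[of f] by simp
    then show ?thesis using PInf by simp
  next
    case MInf
    then show ?thesis using lower_order_growth_nonneg[of f] by simp
  qed
qed

theorem theorem3:
  fixes k :: nat and A :: "complex \<Rightarrow> complex" and p1 p2 :: real
  assumes "k \<ge> 1"
    and "A analytic_on ball 0 1"
    and "degree_growth A = ereal p2"
    and "0 < p2"
    and "lower_degree_growth A = ereal p1"
  shows "(\<forall>f. disc_solution k A f \<and> order_growth f > 0 \<longrightarrow>
            ereal (p1 / real k - 1)
              \<le> 1 + max (lower_order_growth f - lower_order_growth f / order_growth f) 0)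
       \<and> (2 * real k < real k * (2 + (p2 - 2 * real k) / p2)
          \<and> real k * (2 + (p2 - 2 * real k) / p2) < p1 \<and> p1 \<le> p2 \<longrightarrow>
          (\<forall>f. disc_solution k A f \<and> nontrivial_on_disc f \<longrightarrow>
             lower_order_growth f - (1 - lower_order_growth f / order_growth f)
               \<le> ereal (p1 / real k - 1)
             \<and> p1 / real k - 1 \<le> p2 / real k - 1
             \<and> ereal (p2 / real k - 1) = order_growth f))"
proof (intro conjI impI allI)
  fix f assume "disc_solution k A f \<and> order_growth f > 0"
  then show "ereal (p1 / real k - 1)
      \<le> 1 + max (lower_order_growth f - lower_order_growth f / order_growth f) 0"
    using lower_degree_bound[OF assms(1,2,5)] by blast
next
  fix f
  assume hyp: "2 * real k < real k * (2 + (p2 - 2 * real k) / p2)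
      \<and> real k * (2 + (p2 - 2 * real k) / p2) < p1 \<and> p1 \<le> p2"
  then show "p1 / real k - 1 \<le> p2 / real k - 1" by (simp add: divide_right_mono)
  assume "disc_solution k A f \<and> nontrivial_on_disc f"
  then have sol: "disc_solution k A f" and nontriv: "nontrivial_on_disc f" by auto
  have k: "0 < real k" using assms(1) by simp
  have p1: "0 < p1" using hyp k by linarith
  have "2 * real k < p1" using hyp by linarith
  then have p2: "2 * real k < p2" using hyp by linarith
  have le: "order_growth f \<le> ereal (p2 / real k - 1)"
    using order_growth_le[OF sol assms(1,2,3)] p2 k by simp
  have "0 \<le> lower_order_growth f" "lower_order_growth f \<le> order_growth f"
    by (rule lower_order_growth_nonneg, rule lower_order_growth_le_order_growth)
  with le obtain l S where l: "lower_order_growth f = ereal l" and S: "order_growth f = ereal S" and "0 \<le> l" "l \<le> S"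
    by (cases "lower_order_growth f"; cases "order_growth f") auto
  \<comment> \<open>Because \<open>p2 / k > 2\<close>, the maximum cannot be \<open>1\<close>; this
    gives \<open>p2 / k - 1 \<le> S\<close>, the reverse of the bound from the majorant.\<close>
  have "p2 \<le> (max S 1 + 1) * real k"
    by (rule degree_le_of_finite_order[OF sol nontriv assms(2,3) S])
  then have "p2 / real k \<le> max S 1 + 1" using k by (simp add: field_simps)
  moreover have "2 < p2 / real k" using p2 k by (simp add: field_simps)
  ultimately have "p2 / real k - 1 \<le> S" by linarith
  then have Seq: "S = p2 / real k - 1" using le S by simp
  then show "ereal (p2 / real k - 1) = order_growth f" by (simp add: S)
  have S1: "1 < S" using Seq \<open>2 < p2 / real k\<close> by simp
  have "l \<le> p1 * (p2 / real k - 1) / p2"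
    using lower_order_growth_le[OF sol assms(1,2,3) _ assms(5) p1 l] p2 k by simp
  then have "l \<le> p1 * S / p2" by (simp add: Seq)
  \<comment> \<open>Expressing \<open>p2\<close> through the order turns
    \<open>l \<le> p1 * S / p2\<close> into \<open>l * (1 + 1 / S) \<le> p1 / k\<close>, which
    rearranges to the claim.\<close>
  moreover have "p2 = (S + 1) * real k" using Seq k by simp
  ultimately have "l * ((S + 1) * real k) \<le> p1 * S" using S1 k by (simp add: pos_le_divide_eq)
  then have "l * (1 + 1 / S) \<le> p1 / real k" using S1 k by (simp add: field_simps)
  then have "l - (1 - l / S) \<le> p1 / real k - 1" by (simp add: algebra_simps)
  then show "lower_order_growth f - (1 - lower_order_growth f / order_growth f) \<le> ereal (p1 / real k - 1)"
    using S1 by (simp add: l S one_ereal_def)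
qed

end
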